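(* Let $\Gamma ~|~ \gamma \vdash \phi$ be a sequent which is provable in the proof system for entailment semantics extended with the rule PS-$\Theta$. Then it is $\Theta$-valid.
   Context: A team over a first-order structure $M$ is a set of assignments with a common finite domain. $\mathrm{Rel}(X)=\{s(\bar z):s\in X\}$. A general model $(M,\mathcal G)$ consists of a structure $M$ and a set $\mathcal G$ of teams. It must satisfy the following: for every first-order formula $\phi(x_1\ldots x_n,\bar m,\bar R)$ with element parameters $\bar m$ and relation parameters $R_i=\mathrm{Rel}(X_i)$, $X_i\in\mathcal G$, the team $\|\phi\|_M=\{s:\mathrm{Dom}(s)=\{x_1\ldots x_n\},M\models_s\phi\}$ is in $\mathcal G$. Satisfaction $(M,\mathcal G)\models_X\phi$ for $X\in\mathcal G$ and $\phi$ in negation normal form: - literals: every $s\in X$ satisfies them; - $\bar t_2\perp_{\bar t_1}\bar t_3$: for $s,s'\in X$ with $\bar t_1\langle s\rangle=\bar t_1\langle s'\rangle$ there is $s''\in X$ agreeing with $s$ on $\bar t_1\bar t_2$ and with $s'$ on $\bar t_1\bar t_3$; - $\psi_1\vee\psi_2$: $X=Y\cup Z$ with $Y,Z\in\mathcal G$, $Y$ satisfying $\psi_1$ and $Z$ satisfying $\psi_2$; - $\wedge$: both conjuncts; - $\exists x\psi$: some $X'\in\mathcal G$ with $\mathrm{Dom}(X')=\mathrm{Dom}(X)\cup\{x\}$ and the same restriction as $X$ to $\mathrm{Dom}(X)\setminus\{x\}$ satisfies $\psi$; - $\forall x\psi$: $X[M/x]=\{s[m/x]:s\in X,m\in\mathrm{Dom}(M)\}$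 satisfies $\psi$. A relation existence theory $\Theta$ is a set of sentences $\exists\bar R\,\theta(\bar R)$ with $\theta$ first-order. $(M,\mathcal G)$ is $\Theta$-closed iff for each such sentence there are teams $\bar X\in\mathcal G$ with $M\models\theta[\mathrm{Rel}(\bar X)/\bar R]$. Sequents $\Gamma~|~\gamma\vdash\phi$ have: - $\Gamma$ a set of first-order formulas with only parameter variables free; - $\gamma$ first-order; - $\phi$ an independence logic formula without parameter variables. $\|\gamma\|_h=\{s:\mathrm{Dom}(s)=\mathrm{Free}_T(\gamma),M\models_{h\cup s}\gamma\}$. The sequent is $\Theta$-valid iff for all $\Theta$-closed $(M,\mathcal G)$ and all parameter assignments $h$ with domain $\mathrm{Free}_P(\Gamma)\cup\mathrm{Free}_P(\gamma)$ and $M\models_h\Gamma$, we have $(M,\mathcal G)\models_{\|\gamma\|_h}\phi$. The base proof system consists of: - Axioms PS-lit: $\forall\bar v(\gamma\to\phi)~|~\gamma\vdash\phi$. - PS-ind: $\forall\bar v_1\bar v_2((\gamma(\bar v_1)\wedge\gamma(\bar v_2)\wedge\bar t_1(\bar v_1)=\bar t_1(\bar v_2))\to\exists\bar v_3(\gamma(\bar v_3)\wedge\bar t_1\bar t_2(\bar v_3)=\bar t_1\bar t_2(\bar v_1)\wedge\bar t_1\bar t_3(\bar v_3)=\bar t_1\bar t_3(\bar v_2)))~|~\gamma\vdash\bar t_2\perp_{\bar t_1}\bar t_3$. - PS-$\vee$: from $\Gamma_i~|~\gamma_i\vdash\phi_i$ infer $\Gamma_1,\Gamma_2,\forall\bar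 v(\gamma\leftrightarrow\gamma_1\vee\gamma_2)~|~\gamma\vdash\phi_1\vee\phi_2$. - PS-$\wedge$: from $\Gamma_i~|~\gamma\vdash\phi_i$ infer $\Gamma_1,\Gamma_2~|~\gamma\vdash\phi_1\wedge\phi_2$. - PS-$\exists$: from $\Gamma~|~\gamma'\vdash\phi$ infer $\Gamma,\forall\bar v(\exists x\gamma'\leftrightarrow\exists x\gamma)~|~\gamma\vdash\exists x\phi$. - PS-$\forall$: from $\Gamma~|~\gamma'\vdash\phi$ infer $\Gamma,\forall\bar v(\gamma'\leftrightarrow\exists x\gamma)~|~\gamma\vdash\forall x\phi$. - PS-ent: replace $\Gamma$ by any $\Gamma'$ with $\bigwedge\Gamma'\models\bigwedge\Gamma$. - PS-depar: from $\Gamma~|~\gamma\vdash\phi$ infer $\exists p\bigwedge\Gamma~|~\gamma\vdash\phi$ for a parameter $p$ not free in $\gamma$. - PS-split: from $\Gamma_1~|~\gamma\vdash\phi$ and $\Gamma_2~|~\gamma\vdash\phi$ infer $(\bigwedge\Gamma_1)\vee(\bigwedge\Gamma_2)~|~\gamma\vdash\phi$. Rule PS-$\Theta$: if $\Gamma_1(\bar S),\Gamma_2~|~\gamma\vdash\phi$ is provable, the relation symbols $\bar S$ do not occur in $\Gamma_2,\gamma,\phi$, and $\exists\bar R\bigwedge\Gamma_1(\bar R)\in\Theta$, then $\Gamma_2~|~\gamma\vdash\phi$ is provable.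
   Formalization: In rule PS-Θ the symbols S̄ are also required not to occur unbound in the sentences of Θ; without this the rule is unsound, e.g. for Θ = {∃R∀x¬Rx, ∃Q∃xPx} with S = P. *)

theory Defs
  imports Main
begin

section \<open>Syntax\<close>

text \<open>
  Symbols carry their arity implicitly: \<open>f\<close> applied to \<open>k\<close> arguments is the \<open>k\<close>-ary function
  symbol \<open>f\<close>, and \<open>r\<close> applied to \<open>k\<close> arguments is the relation symbol \<open>(r, k)\<close>. Hence every
  formula is well-formed.
\<close>

datatype ('f, tm_vars: 'v) tm = Var 'v | Fun 'f "('f, 'v) tm list"

datatype ('f, 'r, atom_vars: 'v) atom =
  Eq "('f, 'v) tm" "('f, 'v) tm" | Rel 'r "('f, 'v) tm list"

datatype ('f, 'r, literal_vars: 'v) literal = PosL "('f, 'r, 'v) atom" | NegL "('f, 'r, 'v) atom"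

datatype var = TV nat | PV nat  \<comment> \<open>team variables and parameter variables\<close>

type_synonym 'r rsym = "'r \<times> nat"

datatype ('f, 'r, 'v) fo =
    Atom "('f, 'r, 'v) atom"
  | FNot "('f, 'r, 'v) fo"
  | FAnd "('f, 'r, 'v) fo" "('f, 'r, 'v) fo"
  | FOr "('f, 'r, 'v) fo" "('f, 'r, 'v) fo"
  | FEx 'v "('f, 'r, 'v) fo"
  | FAll 'v "('f, 'r, 'v) fo"

type_synonym ('f, 'r) form = "('f, 'r, var) fo"

text \<open>
  Independence logic formulas, in negation normal form. Their variables are (indices of) team
  variables, so parameter variables cannot occur. \<open>IIndep t2 t1 t3\<close> is $t_2 \perp_{t_1} t_3$.
\<close>

datatype ('f, 'r) il =
    ILit "('f, 'r, nat) literal"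
  | IIndep "('f, nat) tm list" "('f, nat) tm list" "('f, nat) tm list"
  | IOr "('f, 'r) il" "('f, 'r) il"
  | IAnd "('f, 'r) il" "('f, 'r) il"
  | IEx nat "('f, 'r) il"
  | IAll nat "('f, 'r) il"

abbreviation FImp :: "('f, 'r, 'v) fo \<Rightarrow> ('f, 'r, 'v) fo \<Rightarrow> ('f, 'r, 'v) fo" where
  "FImp \<phi> \<psi> \<equiv> FOr (FNot \<phi>) \<psi>"

abbreviation FIff :: "('f, 'r, 'v) fo \<Rightarrow> ('f, 'r, 'v) fo \<Rightarrow> ('f, 'r, 'v) fo" where
  "FIff \<phi> \<psi> \<equiv> FAnd (FImp \<phi> \<psi>) (FImp \<psi> \<phi>)"

definition FTop :: "('f, 'r) form" where
  "FTop = FAll (TV 0) (Atom (Eq (Var (TV 0)) (Var (TV 0))))"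

fun FConj :: "('f, 'r) form list \<Rightarrow> ('f, 'r) form" where
  "FConj [] = FTop"
| "FConj [\<phi>] = \<phi>"
| "FConj (\<phi> # \<psi> # \<phi>s) = FAnd \<phi> (FConj (\<psi> # \<phi>s))"

definition FAlls :: "nat list \<Rightarrow> ('f, 'r) form \<Rightarrow> ('f, 'r) form" where
  "FAlls xs \<phi> = foldr (\<lambda>x. FAll (TV x)) xs \<phi>"

definition FExs :: "nat list \<Rightarrow> ('f, 'r) form \<Rightarrow> ('f, 'r) form" where
  "FExs xs \<phi> = foldr (\<lambda>x. FEx (TV x)) xs \<phi>"

definition FEqs :: "('f, var) tm list \<Rightarrow> ('f, var) tm list \<Rightarrow> ('f, 'r) form" where
  "FEqs ts us = FConj (map2 (\<lambda>t u. Atom (Eq t u)) ts us)"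

fun literal_fo :: "('f, 'r, nat) literal \<Rightarrow> ('f, 'r) form" where
  "literal_fo (PosL a) = Atom (map_atom id id TV a)"
| "literal_fo (NegL a) = FNot (Atom (map_atom id id TV a))"

primrec fv :: "('f, 'r, 'v) fo \<Rightarrow> 'v set" where
  "fv (Atom a) = atom_vars a"
| "fv (FNot \<phi>) = fv \<phi>"
| "fv (FAnd \<phi> \<psi>) = fv \<phi> \<union> fv \<psi>"
| "fv (FOr \<phi> \<psi>) = fv \<phi> \<union> fv \<psi>"
| "fv (FEx v \<phi>) = fv \<phi> - {v}"
| "fv (FAll v \<phi>) = fv \<phi> - {v}"

primrec all_vars :: "('f, 'r, 'v) fo \<Rightarrow> 'v set" where  \<comment> \<open>free or bound\<close>
  "all_vars (Atom a) = atom_vars a"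
| "all_vars (FNot \<phi>) = all_vars \<phi>"
| "all_vars (FAnd \<phi> \<psi>) = all_vars \<phi> \<union> all_vars \<psi>"
| "all_vars (FOr \<phi> \<psi>) = all_vars \<phi> \<union> all_vars \<psi>"
| "all_vars (FEx v \<phi>) = insert v (all_vars \<phi>)"
| "all_vars (FAll v \<phi>) = insert v (all_vars \<phi>)"

definition free_T :: "('f, 'r) form \<Rightarrow> nat set" where
  "free_T \<phi> = {x. TV x \<in> fv \<phi>}"

definition free_P :: "('f, 'r) form \<Rightarrow> nat set" where
  "free_P \<phi> = {p. PV p \<in> fv \<phi>}"

primrec il_fv :: "('f, 'r) il \<Rightarrow> nat set" where
  "il_fv (ILit l) = literal_vars l"
| "il_fv (IIndep t2 t1 t3) = (\<Union>t \<in> set t1 \<union> set t2 \<union> set t3. tm_vars t)"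
| "il_fv (IOr \<phi> \<psi>) = il_fv \<phi> \<union> il_fv \<psi>"
| "il_fv (IAnd \<phi> \<psi>) = il_fv \<phi> \<union> il_fv \<psi>"
| "il_fv (IEx x \<phi>) = il_fv \<phi> - {x}"
| "il_fv (IAll x \<phi>) = il_fv \<phi> - {x}"

fun atom_rsyms :: "('f, 'r, 'v) atom \<Rightarrow> 'r rsym set" where
  "atom_rsyms (Eq t u) = {}"
| "atom_rsyms (Rel r ts) = {(r, length ts)}"

fun literal_rsyms :: "('f, 'r, 'v) literal \<Rightarrow> 'r rsym set" where
  "literal_rsyms (PosL a) = atom_rsyms a"
| "literal_rsyms (NegL a) = atom_rsyms a"

primrec rsyms :: "('f, 'r, 'v) fo \<Rightarrow> 'r rsym set" where
  "rsyms (Atom a) = atom_rsyms a"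
| "rsyms (FNot \<phi>) = rsyms \<phi>"
| "rsyms (FAnd \<phi> \<psi>) = rsyms \<phi> \<union> rsyms \<psi>"
| "rsyms (FOr \<phi> \<psi>) = rsyms \<phi> \<union> rsyms \<psi>"
| "rsyms (FEx v \<phi>) = rsyms \<phi>"
| "rsyms (FAll v \<phi>) = rsyms \<phi>"

primrec il_rsyms :: "('f, 'r) il \<Rightarrow> 'r rsym set" where
  "il_rsyms (ILit l) = literal_rsyms l"
| "il_rsyms (IIndep t2 t1 t3) = {}"
| "il_rsyms (IOr \<phi> \<psi>) = il_rsyms \<phi> \<union> il_rsyms \<psi>"
| "il_rsyms (IAnd \<phi> \<psi>) = il_rsyms \<phi> \<union> il_rsyms \<psi>"
| "il_rsyms (IEx x \<phi>) = il_rsyms \<phi>"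
| "il_rsyms (IAll x \<phi>) = il_rsyms \<phi>"

text \<open>
  Renaming of free variables. It does not rename bound variables, so it is only used with target
  variables that do not occur in the formula.
\<close>

primrec rename_vars :: "('v \<Rightarrow> 'v) \<Rightarrow> ('f, 'r, 'v) fo \<Rightarrow> ('f, 'r, 'v) fo" where
  "rename_vars \<rho> (Atom a) = Atom (map_atom id id \<rho> a)"
| "rename_vars \<rho> (FNot \<phi>) = FNot (rename_vars \<rho> \<phi>)"
| "rename_vars \<rho> (FAnd \<phi> \<psi>) = FAnd (rename_vars \<rho> \<phi>) (rename_vars \<rho> \<psi>)"
| "rename_vars \<rho> (FOr \<phi> \<psi>) = FOr (rename_vars \<rho> \<phi>) (rename_vars \<rho> \<psi>)"
| "rename_vars \<rho> (FEx v \<phi>) = FEx v (rename_vars (\<rho>(v := v)) \<phi>)"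
| "rename_vars \<rho> (FAll v \<phi>) = FAll v (rename_vars (\<rho>(v := v)) \<phi>)"

definition replace :: "'a list \<Rightarrow> 'a list \<Rightarrow> 'a \<Rightarrow> 'a" where
  "replace xs ys x = (case map_of (zip xs ys) x of None \<Rightarrow> x | Some y \<Rightarrow> y)"

definition fo_at :: "('f, 'r) form \<Rightarrow> nat list \<Rightarrow> nat list \<Rightarrow> ('f, 'r) form" where
  "fo_at \<gamma> xs ys = rename_vars (replace (map TV xs) (map TV ys)) \<gamma>"

definition tms_at :: "('f, nat) tm list \<Rightarrow> nat list \<Rightarrow> nat list \<Rightarrow> ('f, var) tm list" where
  "tms_at ts xs ys = map (map_tm id (\<lambda>x. TV (replace xs ys x))) ts"

text \<open>Simultaneous replacement of relation symbols; \<open>Ss\<close> must have the same arities as \<open>Rs\<close>.\<close>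

fun replace_rsyms_atom :: "'r rsym list \<Rightarrow> 'r rsym list \<Rightarrow> ('f, 'r, 'v) atom \<Rightarrow> ('f, 'r, 'v) atom" where
  "replace_rsyms_atom Rs Ss (Eq t u) = Eq t u"
| "replace_rsyms_atom Rs Ss (Rel r ts) = Rel (fst (replace Rs Ss (r, length ts))) ts"

primrec replace_rsyms :: "'r rsym list \<Rightarrow> 'r rsym list \<Rightarrow> ('f, 'r, 'v) fo \<Rightarrow> ('f, 'r, 'v) fo" where
  "replace_rsyms Rs Ss (Atom a) = Atom (replace_rsyms_atom Rs Ss a)"
| "replace_rsyms Rs Ss (FNot \<phi>) = FNot (replace_rsyms Rs Ss \<phi>)"
| "replace_rsyms Rs Ss (FAnd \<phi> \<psi>) = FAnd (replace_rsyms Rs Ss \<phi>) (replace_rsyms Rs Ss \<psi>)"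
| "replace_rsyms Rs Ss (FOr \<phi> \<psi>) = FOr (replace_rsyms Rs Ss \<phi>) (replace_rsyms Rs Ss \<psi>)"
| "replace_rsyms Rs Ss (FEx v \<phi>) = FEx v (replace_rsyms Rs Ss \<phi>)"
| "replace_rsyms Rs Ss (FAll v \<phi>) = FAll v (replace_rsyms Rs Ss \<phi>)"


section \<open>First-order semantics\<close>

record ('f, 'r, 'm) struct =
  Dom :: "'m set"
  fint :: "'f \<Rightarrow> 'm list \<Rightarrow> 'm"
  rint :: "'r rsym \<Rightarrow> 'm list set"

definition is_structure :: "('f, 'r, 'm) struct \<Rightarrow> bool" where
  "is_structure M \<longleftrightarrow> Dom M \<noteq> {} \<and>
     (\<forall>f as. set as \<subseteq> Dom M \<longrightarrow> fint M f as \<in> Dom M) \<and>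
     (\<forall>r k. rint M (r, k) \<subseteq> {as. length as = k \<and> set as \<subseteq> Dom M})"

primrec tm_val :: "('f, 'r, 'm) struct \<Rightarrow> ('v \<Rightarrow> 'm) \<Rightarrow> ('f, 'v) tm \<Rightarrow> 'm" where
  "tm_val M e (Var v) = e v"
| "tm_val M e (Fun f ts) = fint M f (map (tm_val M e) ts)"

fun atom_sat :: "('f, 'r, 'm) struct \<Rightarrow> ('v \<Rightarrow> 'm) \<Rightarrow> ('f, 'r, 'v) atom \<Rightarrow> bool" where
  "atom_sat M e (Eq t u) \<longleftrightarrow> tm_val M e t = tm_val M e u"
| "atom_sat M e (Rel r ts) \<longleftrightarrow> map (tm_val M e) ts \<in> rint M (r, length ts)"

fun literal_sat :: "('f, 'r, 'm) struct \<Rightarrow> ('v \<Rightarrow> 'm) \<Rightarrow> ('f, 'r, 'v) literal \<Rightarrow> bool" where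
  "literal_sat M e (PosL a) \<longleftrightarrow> atom_sat M e a"
| "literal_sat M e (NegL a) \<longleftrightarrow> \<not> atom_sat M e a"

primrec sat :: "('f, 'r, 'm) struct \<Rightarrow> ('v \<Rightarrow> 'm) \<Rightarrow> ('f, 'r, 'v) fo \<Rightarrow> bool" where
  "sat M e (Atom a) \<longleftrightarrow> atom_sat M e a"
| "sat M e (FNot \<phi>) \<longleftrightarrow> \<not> sat M e \<phi>"
| "sat M e (FAnd \<phi> \<psi>) \<longleftrightarrow> sat M e \<phi> \<and> sat M e \<psi>"
| "sat M e (FOr \<phi> \<psi>) \<longleftrightarrow> sat M e \<phi> \<or> sat M e \<psi>"
| "sat M e (FEx v \<phi>) \<longleftrightarrow> (\<exists>m \<in> Dom M. sat M (e(v := m)) \<phi>)"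
| "sat M e (FAll v \<phi>) \<longleftrightarrow> (\<forall>m \<in> Dom M. sat M (e(v := m)) \<phi>)"

text \<open>
  The type \<open>'m\<close> is the universe of all structures considered: entailment, provability and validity
  refer to all structures whose domain is a nonempty subset of \<open>'m\<close>, an arbitrary type.
\<close>

definition entails ::
  "'m itself \<Rightarrow> ('f, 'r) form set \<Rightarrow> ('f, 'r) form set \<Rightarrow> bool" where
  "entails U \<Gamma>' \<Gamma> \<longleftrightarrow>
     (\<forall>(M :: ('f, 'r, 'm) struct) e. is_structure M \<longrightarrow> range e \<subseteq> Dom M \<longrightarrow>
        (\<forall>\<psi> \<in> \<Gamma>'. sat M e \<psi>) \<longrightarrow> (\<forall>\<psi> \<in> \<Gamma>. sat M e \<psi>))"

text \<open>
  The environment $h \cup s$ of a parameter assignment \<open>h\<close> and an assignment \<open>s\<close> to team variables.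
  Values outside the domains of \<open>h\<close> and \<open>s\<close> are never relevant in what follows.
\<close>

fun env :: "(nat \<rightharpoonup> 'm) \<Rightarrow> (nat \<rightharpoonup> 'm) \<Rightarrow> var \<Rightarrow> 'm" where
  "env h s (TV x) = the (s x)"
| "env h s (PV p) = the (h p)"


section \<open>Teams and general models\<close>

text \<open>
  A team is paired with its domain, which the set of assignments alone does not determine
  if it is empty.
\<close>

type_synonym 'm team = "nat set \<times> (nat \<rightharpoonup> 'm) set"

definition assignments :: "('f, 'r, 'm) struct \<Rightarrow> nat set \<Rightarrow> (nat \<rightharpoonup> 'm) set" where
  "assignments M V = {s. dom s = V \<and> ran s \<subseteq> Dom M}"

definition is_team :: "('f, 'r, 'm) struct \<Rightarrow> 'm team \<Rightarrow> bool" where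
  "is_team M X \<longleftrightarrow> finite (fst X) \<and> snd X \<subseteq> assignments M (fst X)"

text \<open>The tuple of variables used to form \<open>rel_of X\<close> lists the domain in increasing order.\<close>

definition rel_of :: "'m team \<Rightarrow> 'm list set" where
  "rel_of X = (\<lambda>s. map (the \<circ> s) (sorted_list_of_set (fst X))) ` snd X"

definition team_arity :: "'m team \<Rightarrow> nat" where
  "team_arity X = card (fst X)"

text \<open>
  Adding relation parameters: the new symbol \<open>Inr X\<close> denotes \<open>rel_of X\<close>. Element parameters
  are the parameter variables of a formula, with their values given by \<open>h\<close>.
\<close>

definition with_team_rels :: "('f, 'r, 'm) struct \<Rightarrow> ('f, 'r + 'm team, 'm) struct" where
  "with_team_rels M = \<lparr>Dom = Dom M, fint = fint M,
     rint = (\<lambda>(r, k). case r of Inl r' \<Rightarrow> rint M (r', k)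
                      | Inr X \<Rightarrow> if k = team_arity X then rel_of X else {})\<rparr>"

definition general_model :: "('f, 'r, 'm) struct \<Rightarrow> 'm team set \<Rightarrow> bool" where
  "general_model M G \<longleftrightarrow> is_structure M \<and> (\<forall>X \<in> G. is_team M X) \<and>
     (\<forall>(\<phi> :: ('f, 'r + 'm team) form) V h.
        finite V \<longrightarrow> free_T \<phi> \<subseteq> V \<longrightarrow> free_P \<phi> \<subseteq> dom h \<longrightarrow> ran h \<subseteq> Dom M \<longrightarrow>
        (\<forall>X k. (Inr X, k) \<in> rsyms \<phi> \<longrightarrow> X \<in> G \<and> k = team_arity X) \<longrightarrow>
        (V, {s \<in> assignments M V. sat (with_team_rels M) (env h s) \<phi>}) \<in> G)"

definition team_val :: "('f, 'r, 'm) struct \<Rightarrow> (nat \<rightharpoonup> 'm) \<Rightarrow> ('f, nat) tm list \<Rightarrow> 'm list" where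
  "team_val M s ts = map (tm_val M (the \<circ> s)) ts"

primrec il_sat ::
  "('f, 'r, 'm) struct \<Rightarrow> 'm team set \<Rightarrow> ('f, 'r) il \<Rightarrow> 'm team \<Rightarrow> bool" where
  "il_sat M G (ILit l) X \<longleftrightarrow> (\<forall>s \<in> snd X. literal_sat M (the \<circ> s) l)"
| "il_sat M G (IIndep t2 t1 t3) X \<longleftrightarrow>
     (\<forall>s \<in> snd X. \<forall>s' \<in> snd X. team_val M s t1 = team_val M s' t1 \<longrightarrow>
        (\<exists>s'' \<in> snd X. team_val M s'' (t1 @ t2) = team_val M s (t1 @ t2) \<and>
                       team_val M s'' (t1 @ t3) = team_val M s' (t1 @ t3)))"
| "il_sat M G (IOr \<psi>1 \<psi>2) X \<longleftrightarrow>
     (\<exists>Y Z. snd X = Y \<union> Z \<and> (fst X, Y) \<in> G \<and> (fst X, Z) \<in> G \<and>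
        il_sat M G \<psi>1 (fst X, Y) \<and> il_sat M G \<psi>2 (fst X, Z))"
| "il_sat M G (IAnd \<psi>1 \<psi>2) X \<longleftrightarrow> il_sat M G \<psi>1 X \<and> il_sat M G \<psi>2 X"
| "il_sat M G (IEx x \<psi>) X \<longleftrightarrow>
     (\<exists>X' \<in> G. fst X' = insert x (fst X) \<and>
        (\<lambda>s. s |` (fst X - {x})) ` snd X' = (\<lambda>s. s |` (fst X - {x})) ` snd X \<and>
        il_sat M G \<psi> X')"
| "il_sat M G (IAll x \<psi>) X \<longleftrightarrow>
     il_sat M G \<psi> (insert x (fst X), {s(x \<mapsto> m) | s m. s \<in> snd X \<and> m \<in> Dom M})"


section \<open>Relation existence theories\<close>

text \<open>\<open>(Rs, \<theta>)\<close> stands for the sentence $\exists Rs\, \theta$.\<close>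

type_synonym ('f, 'r) rel_ex = "'r rsym list \<times> ('f, 'r) form"

definition relation_existence_theory :: "('f, 'r) rel_ex set \<Rightarrow> bool" where
  "relation_existence_theory \<Theta> \<longleftrightarrow> (\<forall>(Rs, \<theta>) \<in> \<Theta>. distinct Rs \<and> fv \<theta> = {})"

definition theory_rsyms :: "('f, 'r) rel_ex set \<Rightarrow> 'r rsym set" where  \<comment> \<open>unbound ones\<close>
  "theory_rsyms \<Theta> = (\<Union>(Rs, \<theta>) \<in> \<Theta>. rsyms \<theta> - set Rs)"

definition interpret_as ::
  "('f, 'r, 'm) struct \<Rightarrow> 'r rsym list \<Rightarrow> 'm team list \<Rightarrow> ('f, 'r, 'm) struct" where
  "interpret_as M Rs Xs = M\<lparr>rint := \<lambda>R. case map_of (zip Rs Xs) R of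
     None \<Rightarrow> rint M R | Some X \<Rightarrow> rel_of X\<rparr>"

definition theory_closed ::
  "('f, 'r) rel_ex set \<Rightarrow> ('f, 'r, 'm) struct \<Rightarrow> 'm team set \<Rightarrow> bool" where
  "theory_closed \<Theta> M G \<longleftrightarrow>
     (\<forall>(Rs, \<theta>) \<in> \<Theta>. \<exists>Xs. set Xs \<subseteq> G \<and> map team_arity Xs = map snd Rs \<and>
        (\<forall>e. range e \<subseteq> Dom M \<longrightarrow> sat (interpret_as M Rs Xs) e \<theta>))"


section \<open>Sequents\<close>

text \<open>
  A triple \<open>\<Gamma>\<close>, \<open>\<gamma>\<close>, \<open>\<phi>\<close> is a sequent. The condition on the free variables of \<open>\<phi>\<close> makes
  satisfaction of \<open>\<phi>\<close> by the team defined by \<open>\<gamma>\<close>, with domain \<open>free_T \<gamma>\<close>, meaningful.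
\<close>

definition sequent :: "('f, 'r) form set \<Rightarrow> ('f, 'r) form \<Rightarrow> ('f, 'r) il \<Rightarrow> bool" where
  "sequent \<Gamma> \<gamma> \<phi> \<longleftrightarrow> (\<forall>\<psi> \<in> \<Gamma>. free_T \<psi> = {}) \<and> il_fv \<phi> \<subseteq> free_T \<gamma>"

definition team_of :: "('f, 'r, 'm) struct \<Rightarrow> (nat \<rightharpoonup> 'm) \<Rightarrow> ('f, 'r) form \<Rightarrow> 'm team" where
  "team_of M h \<gamma> = (free_T \<gamma>, {s \<in> assignments M (free_T \<gamma>). sat M (env h s) \<gamma>})"

definition valid ::
  "'m itself \<Rightarrow> ('f, 'r) rel_ex set \<Rightarrow>
   ('f, 'r) form set \<Rightarrow> ('f, 'r) form \<Rightarrow> ('f, 'r) il \<Rightarrow> bool" where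
  "valid U \<Theta> \<Gamma> \<gamma> \<phi> \<longleftrightarrow>
     (\<forall>(M :: ('f, 'r, 'm) struct) G h. general_model M G \<longrightarrow> theory_closed \<Theta> M G \<longrightarrow>
        dom h = (\<Union>\<psi> \<in> \<Gamma>. free_P \<psi>) \<union> free_P \<gamma> \<longrightarrow> ran h \<subseteq> Dom M \<longrightarrow>
        (\<forall>\<psi> \<in> \<Gamma>. sat M (env h Map.empty) \<psi>) \<longrightarrow>
        il_sat M G \<phi> (team_of M h \<gamma>))"

text \<open>
  Every rule requires its conclusion to be a sequent; in particular the tuples \<open>vs\<close> of universally
  quantified variables must cover all free team variables of the quantified formula. A conjunction
  of a finite set of formulas may be formed in any order: the premise is \<open>set Gs\<close>.

  In rule \<open>theta\<close>, the symbols \<open>Ss\<close> must be fresh also for the sentences of \<open>\<Theta>\<close>. Otherwise the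
  rule is unsound: for $\exists R \forall x (R x \leftrightarrow \neg P x) \in \Theta$, one could
  discharge the contradiction obtained with \<open>P\<close> for \<open>R\<close>.
\<close>

inductive provable ::
  "'m itself \<Rightarrow> ('f, 'r) rel_ex set \<Rightarrow>
   ('f, 'r) form set \<Rightarrow> ('f, 'r) form \<Rightarrow> ('f, 'r) il \<Rightarrow> bool"
  for U :: "'m itself" and \<Theta> :: "('f, 'r) rel_ex set" where
  lit:
    "sequent {FAlls vs (FImp \<gamma> (literal_fo l))} \<gamma> (ILit l) \<Longrightarrow>
     provable U \<Theta> {FAlls vs (FImp \<gamma> (literal_fo l))} \<gamma> (ILit l)"
| ind:
    "distinct vs \<Longrightarrow> set vs = free_T \<gamma> \<Longrightarrow>
     length vs1 = length vs \<Longrightarrow> length vs2 = length vs \<Longrightarrow> length vs3 = length vs \<Longrightarrow>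
     distinct (vs1 @ vs2 @ vs3) \<Longrightarrow> TV ` set (vs1 @ vs2 @ vs3) \<inter> all_vars \<gamma> = {} \<Longrightarrow>
     \<psi> = FAlls (vs1 @ vs2)
       (FImp
         (FConj [fo_at \<gamma> vs vs1, fo_at \<gamma> vs vs2, FEqs (tms_at t1 vs vs1) (tms_at t1 vs vs2)])
         (FExs vs3
           (FConj [fo_at \<gamma> vs vs3,
             FEqs (tms_at (t1 @ t2) vs vs3) (tms_at (t1 @ t2) vs vs1),
             FEqs (tms_at (t1 @ t3) vs vs3) (tms_at (t1 @ t3) vs vs2)]))) \<Longrightarrow>
     sequent {\<psi>} \<gamma> (IIndep t2 t1 t3) \<Longrightarrow>
     provable U \<Theta> {\<psi>} \<gamma> (IIndep t2 t1 t3)"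
| disj:
    "provable U \<Theta> \<Gamma>1 \<gamma>1 \<phi>1 \<Longrightarrow> provable U \<Theta> \<Gamma>2 \<gamma>2 \<phi>2 \<Longrightarrow>
     \<Gamma> = \<Gamma>1 \<union> \<Gamma>2 \<union> {FAlls vs (FIff \<gamma> (FOr \<gamma>1 \<gamma>2))} \<Longrightarrow>
     sequent \<Gamma> \<gamma> (IOr \<phi>1 \<phi>2) \<Longrightarrow> provable U \<Theta> \<Gamma> \<gamma> (IOr \<phi>1 \<phi>2)"
| conj:
    "provable U \<Theta> \<Gamma>1 \<gamma> \<phi>1 \<Longrightarrow> provable U \<Theta> \<Gamma>2 \<gamma> \<phi>2 \<Longrightarrow>
     sequent (\<Gamma>1 \<union> \<Gamma>2) \<gamma> (IAnd \<phi>1 \<phi>2) \<Longrightarrow> provable U \<Theta> (\<Gamma>1 \<union> \<Gamma>2) \<gamma> (IAnd \<phi>1 \<phi>2)"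
| exists:
    "provable U \<Theta> \<Gamma> \<gamma>' \<phi> \<Longrightarrow>
     \<Gamma>' = \<Gamma> \<union> {FAlls vs (FIff (FEx (TV x) \<gamma>') (FEx (TV x) \<gamma>))} \<Longrightarrow>
     sequent \<Gamma>' \<gamma> (IEx x \<phi>) \<Longrightarrow> provable U \<Theta> \<Gamma>' \<gamma> (IEx x \<phi>)"
| forall:
    "provable U \<Theta> \<Gamma> \<gamma>' \<phi> \<Longrightarrow>
     \<Gamma>' = \<Gamma> \<union> {FAlls vs (FIff \<gamma>' (FEx (TV x) \<gamma>))} \<Longrightarrow>
     sequent \<Gamma>' \<gamma> (IAll x \<phi>) \<Longrightarrow> provable U \<Theta> \<Gamma>' \<gamma> (IAll x \<phi>)"
| ent:
    "provable U \<Theta> \<Gamma> \<gamma> \<phi> \<Longrightarrow> entails U \<Gamma>' \<Gamma> \<Longrightarrow>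
     sequent \<Gamma>' \<gamma> \<phi> \<Longrightarrow> provable U \<Theta> \<Gamma>' \<gamma> \<phi>"
| depar:
    "provable U \<Theta> (set Gs) \<gamma> \<phi> \<Longrightarrow> p \<notin> free_P \<gamma> \<Longrightarrow>
     sequent {FEx (PV p) (FConj Gs)} \<gamma> \<phi> \<Longrightarrow> provable U \<Theta> {FEx (PV p) (FConj Gs)} \<gamma> \<phi>"
| split:
    "provable U \<Theta> (set Gs1) \<gamma> \<phi> \<Longrightarrow> provable U \<Theta> (set Gs2) \<gamma> \<phi> \<Longrightarrow>
     sequent {FOr (FConj Gs1) (FConj Gs2)} \<gamma> \<phi> \<Longrightarrow>
     provable U \<Theta> {FOr (FConj Gs1) (FConj Gs2)} \<gamma> \<phi>"
| theta:
    "provable U \<Theta> (replace_rsyms Rs Ss ` set Gs \<union> \<Gamma>2) \<gamma> \<phi> \<Longrightarrow>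
     (Rs, FConj Gs) \<in> \<Theta> \<Longrightarrow> distinct Ss \<Longrightarrow> map snd Ss = map snd Rs \<Longrightarrow>
     set Ss \<inter> ((\<Union>\<psi> \<in> \<Gamma>2. rsyms \<psi>) \<union> rsyms \<gamma> \<union> il_rsyms \<phi> \<union> theory_rsyms \<Theta>) = {} \<Longrightarrow>
     sequent \<Gamma>2 \<gamma> \<phi> \<Longrightarrow> provable U \<Theta> \<Gamma>2 \<gamma> \<phi>"

end

theory Submission
  imports Defs
begin

text \<open>
  The rules are sound one by one. Two facts are not immediate. First, a premise may evaluate its
  formula on a team whose domain differs from that of the conclusion; satisfaction in a general
  model is local (it depends only on the projection of the team to any set of variables containing
  the free ones), because the auxiliary teams needed in the proof are intersections of cylinders
  over teams of the model, hence first-order definable from them. Second, for PS-$\Theta$ the model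
  is expanded by interpreting the fresh symbols as the relations of teams provided by
  $\Theta$-closedness. The same set of teams still gives a general model, since the new symbols
  can be replaced by relation parameters.
\<close>

section \<open>Coincidence and substitution\<close>

text \<open>Locality is not automatic in a general model. A witness for a disjunction or an
  existential quantifier must itself belong to \<open>G\<close>, so carrying it over to another team
  means defining the copy by a first-order formula with teams of \<open>G\<close> as relation
  parameters. The copy has to meet two demands at once: fit the target team, and look on the shared
  variables like the old witness. This is where intersections of two cylinders come from. The union
  in a disjunction need not be disjoint and an existential may assign several values, so the copy
  can contain every assignment that looks right; no choice has to be defined.

  The domains differ because a domain is read off the free variables of a formula. An equivalence
  between \<gamma> and \<gamma>1 \<or> \<gamma>2 allows each of the three formulas to have team
  variables on which nothing depends, such as a conjunct x = x.\<close>

lemma tm_val_cong: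
  "(\<And>v. v \<in> tm_vars t \<Longrightarrow> e v = e' v) \<Longrightarrow> tm_val M e t = tm_val M e' t"
proof (induction t)
  case (Fun f ts)
  have "map (tm_val M e) ts = map (tm_val M e') ts"
    by (rule map_cong[OF refl], rule Fun.IH) (use Fun.prems in auto)
  then show ?case by (simp only: tm_val.simps)
qed simp

lemma atom_sat_cong:
  "(\<And>v. v \<in> atom_vars a \<Longrightarrow> e v = e' v) \<Longrightarrow> atom_sat M e a = atom_sat M e' a"
proof (cases a)
  case (Eq t u)
  assume "\<And>v. v \<in> atom_vars a \<Longrightarrow> e v = e' v"
  then show ?thesis using Eq tm_val_cong[of t e e' M] tm_val_cong[of u e e' M] by auto
next
  case (Rel r ts)
  assume "\<And>v. v \<in> atom_vars a \<Longrightarrow> e v = e' v"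
  then have "map (tm_val M e) ts = map (tm_val M e') ts"
    using Rel by (auto intro!: tm_val_cong)
  then show ?thesis by (simp only: Rel atom_sat.simps)
qed

lemma literal_sat_cong:
  "(\<And>v. v \<in> literal_vars l \<Longrightarrow> e v = e' v) \<Longrightarrow> literal_sat M e l = literal_sat M e' l"
  by (cases l) (auto cong: atom_sat_cong)

lemma sat_cong:
  "(\<And>v. v \<in> fv \<phi> \<Longrightarrow> e v = e' v) \<Longrightarrow> sat M e \<phi> = sat M e' \<phi>"
proof (induction \<phi> arbitrary: e e')
  case (Atom a)
  then show ?case using atom_sat_cong[of a e e' M] by simp
next
  case (FNot \<phi>)
  then show ?case by (metis fv.simps(2) sat.simps(2))
next
  case (FAnd \<phi> \<psi>)
  then show ?case by (metis UnI1 UnI2 fv.simps(3) sat.simps(3))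
next
  case (FOr \<phi> \<psi>)
  then show ?case by (metis UnI1 UnI2 fv.simps(4) sat.simps(4))
next
  case (FEx v \<phi>)
  have "sat M (e(v := m)) \<phi> = sat M (e'(v := m)) \<phi>" for m
    by (rule FEx.IH) (use FEx.prems in auto)
  then show ?case by simp
next
  case (FAll v \<phi>)
  have "sat M (e(v := m)) \<phi> = sat M (e'(v := m)) \<phi>" for m
    by (rule FAll.IH) (use FAll.prems in auto)
  then show ?case by simp
qed

section \<open>Renaming of variables and of relation symbols\<close>

lemma tm_val_map_tm: "tm_val M e (map_tm id \<rho> t) = tm_val M (e \<circ> \<rho>) t"
  by (induction t) (auto simp: comp_def cong: map_cong)

lemma atom_sat_map_atom: "atom_sat M e (map_atom id id \<rho> a) = atom_sat M (e \<circ> \<rho>) a"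
proof (cases a)
  case (Eq t u)
  then show ?thesis by (simp add: tm_val_map_tm)
next
  case (Rel r ts)
  have "tm_val M e \<circ> map_tm id \<rho> = tm_val M (e \<circ> \<rho>)"
    by (auto simp: tm_val_map_tm)
  then show ?thesis using Rel by simp
qed

lemma sat_literal_fo: "sat M e (literal_fo l) = literal_sat M (e \<circ> TV) l"
  by (cases l) (simp_all add: atom_sat_map_atom)

text \<open>\<open>rename_vars\<close> does not avoid capture, so targets are kept away from bound
  variables too, by \<open>all_vars\<close>. The alternative \<open>\<rho> v = v\<close> lets the
  hypothesis survive a quantifier, which turns its own variable into a fixed point, and admits the
  parameter variables, which \<open>fo_at\<close> leaves fixed.\<close>

lemma sat_rename_vars:
  assumes "\<And>v. v \<in> fv \<phi> \<Longrightarrow> \<rho> v \<notin> all_vars \<phi> \<or> \<rho> v = v"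
  shows "sat M e (rename_vars \<rho> \<phi>) = sat M (e \<circ> \<rho>) \<phi>"
  using assms
proof (induction \<phi> arbitrary: e \<rho>)
  case (Atom a)
  then show ?case by (simp only: rename_vars.simps sat.simps atom_sat_map_atom)
next
  case (FNot \<phi>)
  have "sat M e (rename_vars \<rho> \<phi>) = sat M (e \<circ> \<rho>) \<phi>"
    by (rule FNot.IH) (use FNot.prems in auto)
  then show ?case by (simp add: comp_def)
next
  case (FAnd \<phi> \<psi>)
  have "sat M e (rename_vars \<rho> \<phi>) = sat M (e \<circ> \<rho>) \<phi>"
    "sat M e (rename_vars \<rho> \<psi>) = sat M (e \<circ> \<rho>) \<psi>"
    by (rule FAnd.IH; use FAnd.prems in auto)+
  then show ?case by (simp add: comp_def)
next
  case (FOr \<phi> \<psi>)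
  have "sat M e (rename_vars \<rho> \<phi>) = sat M (e \<circ> \<rho>) \<phi>"
    "sat M e (rename_vars \<rho> \<psi>) = sat M (e \<circ> \<rho>) \<psi>"
    by (rule FOr.IH; use FOr.prems in auto)+
  then show ?case by (simp add: comp_def)
next
  case (FEx v \<phi>)
  have "sat M (e(v := m)) (rename_vars (\<rho>(v := v)) \<phi>) = sat M ((e \<circ> \<rho>)(v := m)) \<phi>" for m
  proof -
    have "sat M (e(v := m)) (rename_vars (\<rho>(v := v)) \<phi>) = sat M (e(v := m) \<circ> \<rho>(v := v)) \<phi>"
      by (rule FEx.IH) (use FEx.prems in auto)
    \<comment> \<open>At a free variable \<open>w\<close> other than \<open>v\<close> this needs
      \<open>\<rho> w \<noteq> v\<close>: either \<open>\<rho> w\<close> avoids all variables of the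
      formula, \<open>v\<close> included, or it is \<open>w\<close> itself.\<close>
    also have "\<dots> = sat M ((e \<circ> \<rho>)(v := m)) \<phi>"
      by (rule sat_cong) (use FEx.prems in \<open>fastforce\<close>)
    finally show ?thesis .
  qed
  then show ?case by (simp add: comp_def)
next
  case (FAll v \<phi>)
  have "sat M (e(v := m)) (rename_vars (\<rho>(v := v)) \<phi>) = sat M ((e \<circ> \<rho>)(v := m)) \<phi>" for m
  proof -
    have "sat M (e(v := m)) (rename_vars (\<rho>(v := v)) \<phi>) = sat M (e(v := m) \<circ> \<rho>(v := v)) \<phi>"
      by (rule FAll.IH) (use FAll.prems in auto)
    also have "\<dots> = sat M ((e \<circ> \<rho>)(v := m)) \<phi>"
      by (rule sat_cong) (use FAll.prems in \<open>fastforce\<close>)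
    finally show ?thesis .
  qed
  then show ?case by (simp add: comp_def)
qed

text \<open>The map sees the arity because a symbol is a name together with an arity, and it may
  change the type of names. This covers embedding a formula by \<open>Inl\<close>, trading symbols
  for team parameters, and \<open>replace_rsyms\<close>.\<close>

primrec map_rsyms :: "('r rsym \<Rightarrow> 's) \<Rightarrow> ('f, 'r, 'v) fo \<Rightarrow> ('f, 's, 'v) fo" where
  "map_rsyms g (Atom a) =
     Atom (case a of Eq t u \<Rightarrow> Eq t u | Rel r ts \<Rightarrow> Rel (g (r, length ts)) ts)"
| "map_rsyms g (FNot \<phi>) = FNot (map_rsyms g \<phi>)"
| "map_rsyms g (FAnd \<phi> \<psi>) = FAnd (map_rsyms g \<phi>) (map_rsyms g \<psi>)"
| "map_rsyms g (FOr \<phi> \<psi>) = FOr (map_rsyms g \<phi>) (map_rsyms g \<psi>)"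
| "map_rsyms g (FEx v \<phi>) = FEx v (map_rsyms g \<phi>)"
| "map_rsyms g (FAll v \<phi>) = FAll v (map_rsyms g \<phi>)"

lemma fv_map_rsyms [simp]: "fv (map_rsyms g \<phi>) = fv \<phi>"
  by (induction \<phi>) (auto split: atom.split)

lemma free_map_rsyms [simp]:
  "free_T (map_rsyms g \<phi>) = free_T \<phi>" "free_P (map_rsyms g \<phi>) = free_P \<phi>"
  by (simp_all add: free_T_def free_P_def)

lemma rsyms_map_rsyms: "rsyms (map_rsyms g \<phi>) = (\<lambda>R. (g R, snd R)) ` rsyms \<phi>"
  by (induction \<phi>) (auto split: atom.split)

lemma map_rsyms_fst [simp]: "map_rsyms fst \<phi> = \<phi>"
  by (induction \<phi>) (auto split: atom.split)

lemma replace_rsyms_eq_map_rsyms: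
  "replace_rsyms Rs Ss \<phi> = map_rsyms (fst \<circ> replace Rs Ss) \<phi>"
proof (induction \<phi>)
  case (Atom a)
  then show ?case by (cases a) auto
qed auto

lemma tm_val_fint_cong:
  assumes "fint M = fint N"
  shows "tm_val M e = tm_val N e"
proof
  show "tm_val M e t = tm_val N e t" for t
    by (induction t) (auto simp: assms cong: map_cong)
qed

lemma sat_map_rsyms:
  assumes "Dom M = Dom N" "fint M = fint N"
    and "\<And>r k. (r, k) \<in> rsyms \<phi> \<Longrightarrow> rint N (g (r, k), k) = rint M (r, k)"
  shows "sat N e (map_rsyms g \<phi>) = sat M e \<phi>"
  using assms(3)
proof (induction \<phi> arbitrary: e)
  case (Atom a)
  have "tm_val N e = tm_val M e"
    using tm_val_fint_cong assms(2) by metis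
  then show ?case using Atom by (cases a) auto
qed (use assms(1) in auto)

text \<open>The instance \<open>g = fst\<close> of the transfer lemma, where renaming is the
  identity.\<close>

lemma sat_structure_cong:
  assumes "Dom M = Dom N" "fint M = fint N" "\<And>R. R \<in> rsyms \<phi> \<Longrightarrow> rint M R = rint N R"
  shows "sat M e \<phi> = sat N e \<phi>"
  using sat_map_rsyms[of M N \<phi> fst e] assms by auto

lemma literal_sat_structure_cong:
  assumes "fint M = fint N" "\<And>R. R \<in> literal_rsyms l \<Longrightarrow> rint M R = rint N R"
  shows "literal_sat M e l = literal_sat N e l"
proof -
  have "tm_val M e = tm_val N e"
    using tm_val_fint_cong assms(1) by metis
  then have "atom_sat M e a = atom_sat N e a" if "\<And>R. R \<in> atom_rsyms a \<Longrightarrow> rint M R = rint N R" for a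
    using that by (cases a) auto
  then show ?thesis using assms(2) by (cases l) auto
qed

text \<open>Only literals consult relation symbols; since \<open>G\<close> is the same on both
  sides, the team witnesses carry over unchanged.\<close>

lemma il_sat_structure_cong:
  assumes "Dom M = Dom N" "fint M = fint N" "\<And>R. R \<in> il_rsyms \<phi> \<Longrightarrow> rint M R = rint N R"
  shows "il_sat M G \<phi> X = il_sat N G \<phi> X"
  using assms(3)
proof (induction \<phi> arbitrary: X)
  case (ILit l)
  have "literal_sat M e l = literal_sat N e l" for e
    by (rule literal_sat_structure_cong[OF assms(2)]) (use ILit in auto)
  then show ?case by simp
next
  case (IIndep t2 t1 t3)
  have "team_val M = team_val N"
    by (intro ext) (simp add: team_val_def tm_val_fint_cong[OF assms(2)])
  then show ?case by simp
qed (use assms(1) in auto)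

section \<open>Derived connectives and quantifier blocks\<close>

lemma sat_FTop [simp]: "sat M e FTop"
  by (simp add: FTop_def)

lemma sat_FConj: "sat M e (FConj \<phi>s) \<longleftrightarrow> (\<forall>\<phi> \<in> set \<phi>s. sat M e \<phi>)"
  by (induction \<phi>s rule: FConj.induct) auto

lemma rsyms_FConj: "rsyms (FConj \<phi>s) = (\<Union>\<phi> \<in> set \<phi>s. rsyms \<phi>)"
  by (induction \<phi>s rule: FConj.induct) (auto simp: FTop_def)

lemma sat_FExs:
  "sat M e (FExs xs \<phi>) \<longleftrightarrow>
     (\<exists>e'. (\<forall>v. v \<notin> TV ` set xs \<longrightarrow> e' v = e v) \<and> (\<forall>x \<in> set xs. e' (TV x) \<in> Dom M) \<and> sat M e' \<phi>)"
proof (induction xs arbitrary: e)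
  case Nil
  have "e' = e" if "\<forall>v. e' v = e v" for e' using that by auto
  then show ?case by (auto simp: FExs_def)
next
  case (Cons x xs)
  have "sat M e (FExs (x # xs) \<phi>) \<longleftrightarrow> (\<exists>m \<in> Dom M. sat M (e(TV x := m)) (FExs xs \<phi>))"
    by (simp add: FExs_def)
  also have "\<dots> \<longleftrightarrow> (\<exists>e'. (\<forall>v. v \<notin> TV ` set (x # xs) \<longrightarrow> e' v = e v) \<and>
      (\<forall>y \<in> set (x # xs). e' (TV y) \<in> Dom M) \<and> sat M e' \<phi>)" (is "?L \<longleftrightarrow> ?R")
  proof
    assume ?L
    then obtain m e' where m: "m \<in> Dom M"
      and e': "\<forall>v. v \<notin> TV ` set xs \<longrightarrow> e' v = (e(TV x := m)) v"
        "\<forall>y \<in> set xs. e' (TV y) \<in> Dom M" "sat M e' \<phi>"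
      unfolding Cons.IH by blast
    \<comment> \<open>If \<open>x\<close> recurs in \<open>xs\<close>, an inner quantifier has
      overwritten \<open>m\<close>, and the bound comes from \<open>e'\<close> instead.\<close>
    have "e' (TV x) \<in> Dom M"
      using m e' by (cases "x \<in> set xs") auto
    then show ?R using e' by (intro exI[of _ e']) auto
  next
    assume ?R
    then obtain e' where e': "\<forall>v. v \<notin> TV ` set (x # xs) \<longrightarrow> e' v = e v"
      "\<forall>y \<in> set (x # xs). e' (TV y) \<in> Dom M" "sat M e' \<phi>"
      by blast
    show ?L
      unfolding Cons.IH
      by (rule bexI[of _ "e' (TV x)"], rule exI[of _ e']) (use e' in auto)
  qed
  finally show ?case .
qed

lemma sat_FAllsD:
  assumes "sat M e (FAlls xs \<phi>)" "\<And>v. v \<notin> TV ` set xs \<Longrightarrow> e' v = e v"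
    "\<And>x. x \<in> set xs \<Longrightarrow> e' (TV x) \<in> Dom M"
  shows "sat M e' \<phi>"
  using assms
proof (induction xs arbitrary: e)
  case Nil
  then have "e' = e" by auto
  then show ?case using Nil by (simp add: FAlls_def)
next
  case (Cons x xs)
  have "sat M (e(TV x := e' (TV x))) (FAlls xs \<phi>)"
    using Cons.prems(1,3) by (simp add: FAlls_def)
  then show ?case
    by (rule Cons.IH) (use Cons.prems in auto)
qed

lemma fv_FExs: "fv (FExs xs \<phi>) = fv \<phi> - TV ` set xs"
  by (induction xs) (auto simp: FExs_def)

lemma rsyms_FExs: "rsyms (FExs xs \<phi>) = rsyms \<phi>"
  by (induction xs) (auto simp: FExs_def)

lemma sat_FEqs:
  "length ts = length us \<Longrightarrow>
     sat M e (FEqs ts us) \<longleftrightarrow> map (tm_val M e) ts = map (tm_val M e) us"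
  by (induction ts us rule: list_induct2) (auto simp: FEqs_def sat_FConj)

section \<open>Teams as sets of total assignments\<close>

text \<open>
  Working with total functions into the domain avoids partiality: \<open>totals M X\<close> are the
  arbitrary extensions of the members of \<open>X\<close>, and \<open>case_var f h\<close> is the environment given by
  \<open>f\<close> on team variables and \<open>h\<close> on parameter variables.
\<close>

definition asg :: "nat set \<Rightarrow> (nat \<Rightarrow> 'm) \<Rightarrow> (nat \<rightharpoonup> 'm)" where
  "asg V f = (\<lambda>x. if x \<in> V then Some (f x) else None)"

definition totals :: "('f, 'r, 'm) struct \<Rightarrow> 'm team \<Rightarrow> (nat \<Rightarrow> 'm) set" where
  "totals M X = {f. range f \<subseteq> Dom M \<and> asg (fst X) f \<in> snd X}"

lemma asg_eq_iff: "asg V f = asg V g \<longleftrightarrow> (\<forall>x \<in> V. f x = g x)"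
  by (auto simp: asg_def fun_eq_iff)

lemma asg_update: "(asg V f)(x \<mapsto> m) = asg (insert x V) (f(x := m))"
  by (auto simp: asg_def fun_eq_iff)

lemma asg_restrict: "asg V f |` W = asg (V \<inter> W) f"
  by (auto simp: asg_def restrict_map_def fun_eq_iff)

lemma asg_in_assignments: "range f \<subseteq> Dom M \<Longrightarrow> asg V f \<in> assignments M V"
  by (auto simp: asg_def assignments_def dom_def ran_def split: if_splits)

lemma assignmentsE:
  assumes "is_structure M" "s \<in> assignments M V"
  obtains f where "range f \<subseteq> Dom M" "s = asg V f"
proof -
  obtain a where a: "a \<in> Dom M"
    using assms(1) by (auto simp: is_structure_def)
  \<comment> \<open>Outside \<open>V\<close> any element serves; one exists because domains of
    structures are nonempty.\<close>
  define f where "f x = (case s x of None \<Rightarrow> a | Some m \<Rightarrow> m)" for x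
  have "range f \<subseteq> Dom M"
    using a assms(2) ranI[of s] by (fastforce simp: f_def assignments_def split: option.splits)
  moreover have "s = asg V f"
    using assms(2) by (auto simp: f_def asg_def assignments_def fun_eq_iff dom_def split: option.splits)
  ultimately show ?thesis by (rule that)
qed

lemma assignments_in_Dom:
  assumes "s \<in> assignments M V" "x \<in> V"
  shows "the (s x) \<in> Dom M"
proof -
  have "x \<in> dom s" "ran s \<subseteq> Dom M" using assms by (simp_all add: assignments_def)
  then show ?thesis by (auto dest: ranI)
qed

lemma totals_cong:
  "f \<in> totals M X \<Longrightarrow> range g \<subseteq> Dom M \<Longrightarrow> (\<And>x. x \<in> fst X \<Longrightarrow> f x = g x) \<Longrightarrow> g \<in> totals M X"
  using asg_eq_iff[of "fst X" f g] by (auto simp: totals_def)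

lemma totals_range: "f \<in> totals M X \<Longrightarrow> range f \<subseteq> Dom M"
  by (simp add: totals_def)

lemma snd_eq_asg_totals:
  assumes "is_structure M" "is_team M X"
  shows "snd X = asg (fst X) ` totals M X"
proof
  show "snd X \<subseteq> asg (fst X) ` totals M X"
  proof
    fix s assume s: "s \<in> snd X"
    then have "s \<in> assignments M (fst X)" using assms(2) by (auto simp: is_team_def)
    with assms(1) obtain f where "range f \<subseteq> Dom M" "s = asg (fst X) f"
      by (rule assignmentsE)
    then show "s \<in> asg (fst X) ` totals M X" using s by (auto simp: totals_def)
  qed
qed (auto simp: totals_def)

lemma totals_assignments:
  "totals M (V, {s \<in> assignments M V. P s}) = {f. range f \<subseteq> Dom M \<and> P (asg V f)}"
  by (auto simp: totals_def asg_in_assignments)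

text \<open>By coincidence \<gamma> ignores team variables outside \<open>free_T \<gamma>\<close>,
  so arbitrary extensions are harmless and membership in the team becomes plain satisfaction.
  Writing the parameter assignment as \<open>Some \<circ> h\<close> makes it total.\<close>

lemma totals_team_of:
  "totals M (team_of M (Some \<circ> h) \<gamma>) = {f. range f \<subseteq> Dom M \<and> sat M (case_var f h) \<gamma>}"
proof -
  have "sat M (env (Some \<circ> h) (asg (free_T \<gamma>) f)) \<gamma> = sat M (case_var f h) \<gamma>" for f
  proof (rule sat_cong)
    fix v assume "v \<in> fv \<gamma>"
    then show "env (Some \<circ> h) (asg (free_T \<gamma>) f) v = case_var f h v"
      by (cases v) (auto simp: asg_def free_T_def)
  qed
  then show ?thesis
    unfolding team_of_def totals_assignments by auto
qed

lemma fst_team_of [simp]: "fst (team_of M h \<gamma>) = free_T \<gamma>"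
  by (simp add: team_of_def)

text \<open>Inclusion of the projections onto \<open>V\<close>, when \<open>V\<close> lies in both
  domains. The two inclusions are kept apart because locality pulls assignments back along one and
  pushes witnesses forward along the other.\<close>

definition proj_sub :: "('f, 'r, 'm) struct \<Rightarrow> nat set \<Rightarrow> 'm team \<Rightarrow> 'm team \<Rightarrow> bool" where
  "proj_sub M V X Y \<longleftrightarrow> (\<forall>f \<in> totals M X. \<exists>g \<in> totals M Y. \<forall>x \<in> V. f x = g x)"

lemma proj_subE:
  assumes "proj_sub M V X Y" "f \<in> totals M X"
  obtains g where "g \<in> totals M Y" "\<And>x. x \<in> V \<Longrightarrow> f x = g x"
  using assms by (auto simp: proj_sub_def)

lemma proj_subI:
  assumes "\<And>f. f \<in> totals M X \<Longrightarrow> \<exists>g \<in> totals M Y. \<forall>x \<in> V. g x = f x"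
  shows "proj_sub M V X Y"
  unfolding proj_sub_def
proof
  fix f assume "f \<in> totals M X"
  then obtain g where "g \<in> totals M Y" "\<forall>x \<in> V. g x = f x" using assms by blast
  then show "\<exists>g \<in> totals M Y. \<forall>x \<in> V. f x = g x" by (intro bexI[of _ g]) simp
qed

lemma proj_sub_iff:
  assumes "is_structure M" "is_team M X" "is_team M Y" "V \<subseteq> fst X \<inter> fst Y"
  shows "(\<lambda>s. s |` V) ` snd X \<subseteq> (\<lambda>s. s |` V) ` snd Y \<longleftrightarrow> proj_sub M V X Y"
proof -
  have "(\<lambda>s. s |` V) ` snd Z = asg V ` totals M Z" if "is_team M Z" "V \<subseteq> fst Z" for Z
  proof -
    have "fst Z \<inter> V = V" using that(2) by auto
    then show ?thesis
      unfolding snd_eq_asg_totals[OF assms(1) that(1)] by (simp add: image_image asg_restrict)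
  qed
  then have "(\<lambda>s. s |` V) ` snd X = asg V ` totals M X" "(\<lambda>s. s |` V) ` snd Y = asg V ` totals M Y"
    using assms by auto
  then show ?thesis
    by (simp add: proj_sub_def image_subset_iff image_iff asg_eq_iff)
qed

section \<open>The clauses of team satisfaction, read on total assignments\<close>

lemma il_sat_ILit_iff:
  assumes "is_structure M" "is_team M X" "literal_vars l \<subseteq> fst X"
  shows "il_sat M G (ILit l) X \<longleftrightarrow> (\<forall>f \<in> totals M X. literal_sat M f l)"
proof -
  have "literal_sat M (the \<circ> asg (fst X) f) l = literal_sat M f l" for f
    by (rule literal_sat_cong) (use assms(3) in \<open>auto simp: asg_def\<close>)
  then show ?thesis
    by (simp add: snd_eq_asg_totals[OF assms(1,2)])
qed

lemma il_sat_IIndep_iff: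
  assumes "is_structure M" "is_team M X" "il_fv (IIndep t2 t1 t3) \<subseteq> fst X"
  shows "il_sat M G (IIndep t2 t1 t3) X \<longleftrightarrow>
     (\<forall>f \<in> totals M X. \<forall>f' \<in> totals M X. map (tm_val M f) t1 = map (tm_val M f') t1 \<longrightarrow>
        (\<exists>f'' \<in> totals M X. map (tm_val M f'') (t1 @ t2) = map (tm_val M f) (t1 @ t2) \<and>
                       map (tm_val M f'') (t1 @ t3) = map (tm_val M f') (t1 @ t3)))"
proof -
  have team_val: "team_val M (asg (fst X) f) ts = map (tm_val M f) ts"
    if "set ts \<subseteq> set t1 \<union> set t2 \<union> set t3" for f ts
    unfolding team_val_def
  proof (rule map_cong[OF refl])
    fix t assume "t \<in> set ts"
    then have "t \<in> set t1 \<union> set t2 \<union> set t3" using that by blast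
    then have "tm_vars t \<subseteq> fst X"
      using assms(3) by auto
    then show "tm_val M (the \<circ> asg (fst X) f) t = tm_val M f t"
      by (intro tm_val_cong) (auto simp: asg_def)
  qed
  have "team_val M (asg (fst X) f) t1 = map (tm_val M f) t1"
    "team_val M (asg (fst X) f) (t1 @ t2) = map (tm_val M f) (t1 @ t2)"
    "team_val M (asg (fst X) f) (t1 @ t3) = map (tm_val M f) (t1 @ t3)" for f
    by (rule team_val; auto)+
  then show ?thesis
    by (simp add: snd_eq_asg_totals[OF assms(1,2)] del: map_append)
qed

text \<open>Teams with the same domain are determined by their totals, so splitting \<open>X\<close>
  amounts to splitting \<open>totals M X\<close>.\<close>

lemma il_sat_IOr_iff:
  assumes "is_structure M" "\<forall>X \<in> G. is_team M X" "is_team M X"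
  shows "il_sat M G (IOr \<psi>1 \<psi>2) X \<longleftrightarrow>
     (\<exists>Y \<in> G. \<exists>Z \<in> G. fst Y = fst X \<and> fst Z = fst X \<and> totals M X = totals M Y \<union> totals M Z \<and>
        il_sat M G \<psi>1 Y \<and> il_sat M G \<psi>2 Z)" (is "_ \<longleftrightarrow> ?R")
proof
  assume "il_sat M G (IOr \<psi>1 \<psi>2) X"
  then obtain Y Z where YZ: "snd X = Y \<union> Z" "(fst X, Y) \<in> G" "(fst X, Z) \<in> G"
    "il_sat M G \<psi>1 (fst X, Y)" "il_sat M G \<psi>2 (fst X, Z)"
    by auto
  show ?R
    by (rule bexI[OF _ YZ(2)], rule bexI[OF _ YZ(3)]) (use YZ in \<open>auto simp: totals_def\<close>)
next
  assume ?R
  then obtain Y Z where YZ: "Y \<in> G" "Z \<in> G" "fst Y = fst X" "fst Z = fst X"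
    "totals M X = totals M Y \<union> totals M Z" "il_sat M G \<psi>1 Y" "il_sat M G \<psi>2 Z"
    by blast
  have "snd X = snd Y \<union> snd Z"
    using YZ(1-5) assms by (simp add: snd_eq_asg_totals image_Un)
  moreover have "(fst X, snd Y) = Y" "(fst X, snd Z) = Z"
    using YZ(3,4) by (metis prod.collapse)+
  ultimately show "il_sat M G (IOr \<psi>1 \<psi>2) X"
    unfolding il_sat.simps using YZ by (intro exI[of _ "snd Y"] exI[of _ "snd Z"]) simp
qed

lemma il_sat_IEx_iff:
  assumes "is_structure M" "\<forall>X \<in> G. is_team M X" "is_team M X"
  shows "il_sat M G (IEx x \<psi>) X \<longleftrightarrow>
     (\<exists>Y \<in> G. fst Y = insert x (fst X) \<and> proj_sub M (fst X - {x}) X Y \<and>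
        proj_sub M (fst X - {x}) Y X \<and> il_sat M G \<psi> Y)"
proof -
  let ?p = "(\<lambda>s. s |` (fst X - {x}))"
  have "?p ` snd Y = ?p ` snd X \<longleftrightarrow> proj_sub M (fst X - {x}) X Y \<and> proj_sub M (fst X - {x}) Y X"
    if "Y \<in> G" "fst Y = insert x (fst X)" for Y
  proof -
    have "?p ` snd X \<subseteq> ?p ` snd Y \<longleftrightarrow> proj_sub M (fst X - {x}) X Y"
      by (rule proj_sub_iff) (use assms that in auto)
    moreover have "?p ` snd Y \<subseteq> ?p ` snd X \<longleftrightarrow> proj_sub M (fst X - {x}) Y X"
      by (rule proj_sub_iff) (use assms that in auto)
    ultimately show ?thesis by blast
  qed
  then show ?thesis
    unfolding il_sat.simps by (metis (no_types, lifting))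
qed

text \<open>The duplicated team appears as any \<open>Y\<close> with the right totals, because
  \<open>general_model_cylinder\<close> supplies it in this form together with the membership in
  \<open>G\<close> that locality asks for. As \<open>x\<close> may already be in the domain of
  \<open>X\<close>, its old value is disregarded.\<close>

lemma il_sat_IAll_iff:
  assumes "is_structure M" "is_team M X" "is_team M Y" "fst Y = insert x (fst X)"
    and "totals M Y = {f. range f \<subseteq> Dom M \<and> (\<exists>g \<in> totals M X. \<forall>y \<in> fst X - {x}. g y = f y)}"
  shows "il_sat M G (IAll x \<psi>) X \<longleftrightarrow> il_sat M G \<psi> Y"
proof -
  let ?S = "{s(x \<mapsto> m) | s m. s \<in> snd X \<and> m \<in> Dom M}"
  have "snd Y = ?S"
  proof (intro equalityI subsetI)
    fix s assume "s \<in> snd Y"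
    then obtain f where f: "f \<in> totals M Y" "s = asg (fst Y) f"
      using snd_eq_asg_totals[OF assms(1,3)] by auto
    then obtain g where g: "g \<in> totals M X" "\<forall>y \<in> fst X - {x}. g y = f y"
      using assms(5) by auto
    have "s = (asg (fst X) g)(x \<mapsto> f x)"
      unfolding f(2) assms(4) asg_update asg_eq_iff using g(2) by auto
    moreover have "f x \<in> Dom M" using totals_range[OF f(1)] by auto
    moreover have "asg (fst X) g \<in> snd X" using g(1) by (simp add: totals_def)
    ultimately show "s \<in> ?S" by blast
  next
    fix s assume "s \<in> ?S"
    then obtain g m where g: "g \<in> totals M X" "m \<in> Dom M" "s = (asg (fst X) g)(x \<mapsto> m)"
      using snd_eq_asg_totals[OF assms(1,2)] by auto
    have "range (g(x := m)) \<subseteq> Dom M"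
      using totals_range[OF g(1)] g(2) by auto
    then have "g(x := m) \<in> totals M Y"
      using g(1) by (auto simp: assms(5) intro!: bexI[of _ g])
    then show "s \<in> snd Y"
      unfolding g(3) asg_update by (simp add: totals_def assms(4))
  qed
  then have "(insert x (fst X), ?S) = Y"
    using assms(4) by (metis prod.collapse)
  then show ?thesis by simp
qed

section \<open>General models\<close>

lemma general_modelD:
  assumes "general_model M G"
  shows "is_structure M" "\<forall>X \<in> G. is_team M X"
  using assms by (simp_all add: general_model_def)

lemma general_model_definable:
  fixes \<phi> :: "('f, 'r + 'm team) form"
  assumes "general_model M G" "finite V" "free_T \<phi> \<subseteq> V" "free_P \<phi> \<subseteq> dom h" "ran h \<subseteq> Dom M"
    and "\<And>X k. (Inr X, k) \<in> rsyms \<phi> \<Longrightarrow> X \<in> G \<and> k = team_arity X"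
  shows "(V, {s \<in> assignments M V. sat (with_team_rels M) (env h s) \<phi>}) \<in> G"
  using assms unfolding general_model_def by blast

lemma finite_fv: "finite (fv \<phi>)"
proof (induction \<phi>)
  case (Atom a)
  have "finite (tm_vars t)" for t :: "('a, 'c) tm"
    by (induction t) auto
  then show ?case by (cases a) auto
qed auto

lemma finite_free_T: "finite (free_T \<phi>)"
  using finite_vimageI[OF finite_fv, of TV \<phi>] by (simp add: free_T_def vimage_def inj_def)

text \<open>Embedded by \<open>Inl\<close>, the formula \<gamma> is an instance of the closure
  condition without relation parameters.\<close>

lemma team_of_in_general_model:
  assumes "general_model M G" "range h \<subseteq> Dom M"
  shows "team_of M (Some \<circ> h) \<gamma> \<in> G"
proof -
  have sat: "sat (with_team_rels M) e (map_rsyms (Inl \<circ> fst) \<gamma>) = sat M e \<gamma>" for e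
    by (rule sat_map_rsyms) (simp_all add: with_team_rels_def)
  have "ran (Some \<circ> h) \<subseteq> Dom M" using assms(2) by (auto simp: ran_def)
  moreover have "X \<in> G \<and> k = team_arity X" if "(Inr X, k) \<in> rsyms (map_rsyms (Inl \<circ> fst) \<gamma>)" for X k
    using that by (auto simp: rsyms_map_rsyms)
  ultimately have "(free_T \<gamma>, {s \<in> assignments M (free_T \<gamma>).
      sat (with_team_rels M) (env (Some \<circ> h) s) (map_rsyms (Inl \<circ> fst) \<gamma>)}) \<in> G"
    by (intro general_model_definable[OF assms(1)]) (auto simp: finite_free_T dom_def)
  then show ?thesis by (simp add: team_of_def sat)
qed

text \<open>
  Defines the assignments that agree on \<open>V\<close> with a member of \<open>X\<close>. Quantifying the variables
  outside \<open>V\<close> under their own names makes renaming unnecessary.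
\<close>

definition cylinder_fo :: "'m team \<Rightarrow> nat set \<Rightarrow> ('f, 'r + 'm team) form" where
  "cylinder_fo X V = FExs (sorted_list_of_set (fst X - V))
     (Atom (Rel (Inr X) (map (\<lambda>x. Var (TV x)) (sorted_list_of_set (fst X)))))"

lemma sat_cylinder_fo:
  assumes "is_team M X" "V \<subseteq> fst X"
  shows "sat (with_team_rels M) e (cylinder_fo X V) \<longleftrightarrow> (\<exists>t \<in> snd X. \<forall>x \<in> V. the (t x) = e (TV x))"
proof -
  have fin: "finite (fst X)" using assms(1) by (simp add: is_team_def)
  \<comment> \<open>The atom and \<open>rel_of\<close> both list the domain in increasing order, so
    the tuples match position by position.\<close>
  have atom: "sat (with_team_rels M) e'
      (Atom (Rel (Inr X) (map (\<lambda>x. Var (TV x)) (sorted_list_of_set (fst X))))) \<longleftrightarrow>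
      (\<exists>t \<in> snd X. \<forall>x \<in> fst X. the (t x) = e' (TV x))" for e'
    using fin by (simp add: with_team_rels_def team_arity_def rel_of_def comp_def image_iff)
      (metis (no_types))
  show ?thesis
  proof
    assume "sat (with_team_rels M) e (cylinder_fo X V)"
    then obtain e' t where "\<forall>v. v \<notin> TV ` (fst X - V) \<longrightarrow> e' v = e v"
      and "t \<in> snd X" "\<forall>x \<in> fst X. the (t x) = e' (TV x)"
      unfolding cylinder_fo_def sat_FExs atom using fin by auto
    then show "\<exists>t \<in> snd X. \<forall>x \<in> V. the (t x) = e (TV x)"
      using assms(2) by (intro bexI[of _ t]) (auto simp: subset_iff image_iff)
  next
    assume "\<exists>t \<in> snd X. \<forall>x \<in> V. the (t x) = e (TV x)"
    then obtain t where t: "t \<in> snd X" "\<forall>x \<in> V. the (t x) = e (TV x)" by blast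
    then have "t \<in> assignments M (fst X)" using assms(1) by (auto simp: is_team_def)
    then have Dom: "the (t x) \<in> Dom M" if "x \<in> fst X" for x
      using that by (rule assignments_in_Dom)
    \<comment> \<open>The quantified variables take their values from \<open>t\<close>; on
      \<open>V\<close> the environment agrees with \<open>t\<close> already.\<close>
    define e' where "e' v = (case v of TV x \<Rightarrow> if x \<in> fst X - V then the (t x) else e v | PV p \<Rightarrow> e v)" for v
    show "sat (with_team_rels M) e (cylinder_fo X V)"
      unfolding cylinder_fo_def sat_FExs atom
    proof (intro exI[of _ e'] conjI allI ballI impI)
      fix v assume "v \<notin> TV ` set (sorted_list_of_set (fst X - V))"
      then show "e' v = e v" using fin by (cases v) (auto simp: e'_def)
    next
      fix x assume "x \<in> set (sorted_list_of_set (fst X - V))"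
      then show "e' (TV x) \<in> Dom (with_team_rels M)"
        using Dom fin by (auto simp: e'_def with_team_rels_def)
    next
      show "\<exists>t \<in> snd X. \<forall>x \<in> fst X. the (t x) = e' (TV x)"
        using t by (intro bexI[of _ t]) (auto simp: e'_def)
    qed
  qed
qed

text \<open>Apart from the teams \<open>team_of\<close>, all teams constructed for soundness have
  this form or its one-constraint case. One constraint ties the new team to the target, the other to
  an old witness; the new domain \<open>D\<close> is free to drop variables or to add unconstrained
  ones.\<close>

lemma general_model_cylinders:
  assumes G: "general_model M G" and X: "X \<in> G" "V \<subseteq> fst X \<inter> D" and Y: "Y \<in> G" "W \<subseteq> fst Y \<inter> D"
    and D: "finite D"
  shows "\<exists>Z \<in> G. fst Z = D \<and>
    totals M Z = {f. range f \<subseteq> Dom M \<and> (\<exists>g \<in> totals M X. \<forall>x \<in> V. g x = f x) \<and>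
       (\<exists>g \<in> totals M Y. \<forall>x \<in> W. g x = f x)}"
proof (intro bexI conjI)
  note [simp] = general_modelD[OF G]
  define \<phi> :: "('a, 'b + 'c team) form" where "\<phi> = FAnd (cylinder_fo X V) (cylinder_fo Y W)"
  let ?Z = "(D, {s \<in> assignments M D. sat (with_team_rels M) (env Map.empty s) \<phi>})"
  have team: "is_team M X" "is_team M Y" using X Y by simp_all
  then have fin: "finite (fst X)" "finite (fst Y)" by (simp_all add: is_team_def)
  have "fv \<phi> \<subseteq> TV ` D"
    using X Y fin by (auto simp: \<phi>_def cylinder_fo_def fv_FExs)
  then have "free_T \<phi> \<subseteq> D" "free_P \<phi> = {}"
    by (auto simp: free_T_def free_P_def)
  moreover have "Z \<in> G \<and> k = team_arity Z" if "(Inr Z, k) \<in> rsyms \<phi>" for Z k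
    using that X Y fin by (auto simp: \<phi>_def cylinder_fo_def rsyms_FExs team_arity_def)
  ultimately show "?Z \<in> G"
    by (intro general_model_definable[OF G D]) auto
  show "fst ?Z = D" by simp
  have cyl: "sat (with_team_rels M) (env Map.empty (asg D f)) (cylinder_fo T U) \<longleftrightarrow>
      (\<exists>g \<in> totals M T. \<forall>x \<in> U. g x = f x)" if T: "is_team M T" and U: "U \<subseteq> fst T \<inter> D" for T U f
  proof -
    have "U \<subseteq> fst T" using U by simp
    have "(\<forall>x \<in> U. the (asg (fst T) g x) = env Map.empty (asg D f) (TV x)) \<longleftrightarrow>
        (\<forall>x \<in> U. g x = f x)" for g
      by (rule ball_cong[OF refl]) (use U in \<open>auto simp: asg_def\<close>)
    then show ?thesis
      unfolding sat_cylinder_fo[OF T \<open>U \<subseteq> fst T\<close>] snd_eq_asg_totals[OF general_modelD(1)[OF G] T]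
      by simp
  qed
  show "totals M ?Z = {f. range f \<subseteq> Dom M \<and> (\<exists>g \<in> totals M X. \<forall>x \<in> V. g x = f x) \<and>
       (\<exists>g \<in> totals M Y. \<forall>x \<in> W. g x = f x)}"
    unfolding totals_assignments \<phi>_def sat.simps cyl[OF team(1) X(2)] cyl[OF team(2) Y(2)] ..
qed

lemma general_model_cylinder:
  assumes "general_model M G" "X \<in> G" "V \<subseteq> fst X \<inter> D" "finite D"
  shows "\<exists>Z \<in> G. fst Z = D \<and>
    totals M Z = {f. range f \<subseteq> Dom M \<and> (\<exists>g \<in> totals M X. \<forall>x \<in> V. g x = f x)}"
  using general_model_cylinders[OF assms(1-3) assms(2,3,4)] by simp

section \<open>Locality\<close>

text \<open>The set \<open>V\<close> is not fixed to \<open>il_fv \<phi>\<close>: a quantifier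
  passes to \<open>insert x V\<close>, and a binary connective keeps \<open>V\<close> although its
  parts may have fewer free variables. The induction runs over all teams of \<open>G\<close>, since
  the witnesses change the teams.\<close>

lemma il_sat_local:
  assumes "general_model M G" "X \<in> G" "Y \<in> G" "il_fv \<phi> \<subseteq> V" "V \<subseteq> fst X \<inter> fst Y"
    and "proj_sub M V X Y" "proj_sub M V Y X" "il_sat M G \<phi> X"
  shows "il_sat M G \<phi> Y"
  using assms(2-)
proof (induction \<phi> arbitrary: X Y V)
  case (ILit l)
  note M = general_modelD[OF assms(1)]
  have X: "\<forall>f \<in> totals M X. literal_sat M f l"
    using ILit.prems M by (subst (asm) il_sat_ILit_iff) auto
  have "literal_sat M f l" if f: "f \<in> totals M Y" for f
  proof -
    obtain g where g: "g \<in> totals M X" "\<And>x. x \<in> V \<Longrightarrow> f x = g x"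
      using ILit.prems(6) f by (rule proj_subE) blast
    then show ?thesis
      using X ILit.prems(3) literal_sat_cong[of l f g M] by auto
  qed
  then show ?case
    using ILit.prems M by (subst il_sat_ILit_iff) auto
next
  case (IIndep t2 t1 t3)
  note M = general_modelD[OF assms(1)]
  let ?v = "\<lambda>f. map (tm_val M f)"
  have X: "\<forall>f \<in> totals M X. \<forall>f' \<in> totals M X. ?v f t1 = ?v f' t1 \<longrightarrow>
        (\<exists>f'' \<in> totals M X. ?v f'' (t1 @ t2) = ?v f (t1 @ t2) \<and> ?v f'' (t1 @ t3) = ?v f' (t1 @ t3))"
    using IIndep.prems(7) IIndep.prems M by (subst (asm) il_sat_IIndep_iff) blast+
  have v: "?v f t1 = ?v g t1" "?v f (t1 @ t2) = ?v g (t1 @ t2)" "?v f (t1 @ t3) = ?v g (t1 @ t3)"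
    if "\<And>x. x \<in> V \<Longrightarrow> f x = g x" for f g
    using that IIndep.prems(3) by (auto intro!: tm_val_cong)
  have "\<exists>f'' \<in> totals M Y. ?v f'' (t1 @ t2) = ?v f (t1 @ t2) \<and> ?v f'' (t1 @ t3) = ?v f' (t1 @ t3)"
    if f: "f \<in> totals M Y" "f' \<in> totals M Y" "?v f t1 = ?v f' t1" for f f'
  proof -
    \<comment> \<open>Both assignments are pulled back to \<open>X\<close>, independence is applied
      there, and the resulting assignment is pushed forward to \<open>Y\<close>.\<close>
    obtain g where g: "g \<in> totals M X" "\<And>x. x \<in> V \<Longrightarrow> f x = g x"
      using IIndep.prems(6) f(1) by (rule proj_subE) blast
    obtain g' where g': "g' \<in> totals M X" "\<And>x. x \<in> V \<Longrightarrow> f' x = g' x"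
      using IIndep.prems(6) f(2) by (rule proj_subE) blast
    have "?v g t1 = ?v g' t1"
      using f(3) v(1)[OF g(2)] v(1)[OF g'(2)] by simp
    then obtain g'' where g'': "g'' \<in> totals M X" "?v g'' (t1 @ t2) = ?v g (t1 @ t2)"
        "?v g'' (t1 @ t3) = ?v g' (t1 @ t3)"
      using X g(1) g'(1) by blast
    obtain f'' where f'': "f'' \<in> totals M Y" "\<And>x. x \<in> V \<Longrightarrow> g'' x = f'' x"
      using IIndep.prems(5) g''(1) by (rule proj_subE) blast
    show ?thesis
      using f''(1) v(2)[OF g(2)] v(3)[OF g'(2)] g''(2,3) v(2,3)[OF f''(2)]
      by (intro bexI[of _ f'']) (simp_all del: map_append)
  qed
  then show ?case
    using IIndep.prems M by (subst il_sat_IIndep_iff) blast+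
next
  case (IOr \<phi>1 \<phi>2)
  note M = general_modelD[OF assms(1)]
  obtain X1 X2 where Xi: "X1 \<in> G" "X2 \<in> G" "fst X1 = fst X" "fst X2 = fst X"
    "totals M X = totals M X1 \<union> totals M X2" "il_sat M G \<phi>1 X1" "il_sat M G \<phi>2 X2"
    using IOr.prems(7) IOr.prems(1) M by (subst (asm) il_sat_IOr_iff) auto
  have V: "V \<subseteq> fst X" "V \<subseteq> fst Y" using IOr.prems(4) by auto
  have fin: "finite (fst Y)" using IOr.prems(2) M by (auto simp: is_team_def)
  have ex: "\<exists>Y' \<in> G. fst Y' = fst Y \<and>
      totals M Y' = {f \<in> totals M Y. \<exists>g \<in> totals M X'. \<forall>x \<in> V. g x = f x} \<and>
      proj_sub M V X' Y' \<and> proj_sub M V Y' X'"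
    if X': "X' \<in> G" "fst X' = fst X" "totals M X' \<subseteq> totals M X" for X'
  proof -
    \<comment> \<open>The first cylinder, over all of \<open>fst Y\<close>, expresses membership in
      \<open>Y\<close>; the second selects the members that look on \<open>V\<close> like members of
      \<open>X'\<close>.\<close>
    obtain Y' where Y': "Y' \<in> G" "fst Y' = fst Y"
      "totals M Y' = {f. range f \<subseteq> Dom M \<and> (\<exists>g \<in> totals M Y. \<forall>x \<in> fst Y. g x = f x) \<and>
         (\<exists>g \<in> totals M X'. \<forall>x \<in> V. g x = f x)}"
      using general_model_cylinders[OF assms(1) IOr.prems(2) _ X'(1) _ fin, of "fst Y" V] V X'(2)
      by blast
    have t: "totals M Y' = {f \<in> totals M Y. \<exists>g \<in> totals M X'. \<forall>x \<in> V. g x = f x}"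
      unfolding Y'(3) by (auto dest: totals_range intro: totals_cong)
    have "proj_sub M V Y' X'"
      by (rule proj_subI) (simp add: t)
    moreover have "proj_sub M V X' Y'"
      unfolding proj_sub_def
    proof
      fix f assume f: "f \<in> totals M X'"
      then have "f \<in> totals M X" using X'(3) by auto
      with IOr.prems(5) obtain g where "g \<in> totals M Y" "\<And>x. x \<in> V \<Longrightarrow> f x = g x"
        by (rule proj_subE) blast
      then show "\<exists>g \<in> totals M Y'. \<forall>x \<in> V. f x = g x"
        using f unfolding t by auto
    qed
    ultimately show ?thesis using Y'(1,2) t by blast
  qed
  obtain Y1 where Y1: "Y1 \<in> G" "fst Y1 = fst Y" "proj_sub M V X1 Y1" "proj_sub M V Y1 X1"
      "totals M Y1 = {f \<in> totals M Y. \<exists>g \<in> totals M X1. \<forall>x \<in> V. g x = f x}"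
    using ex[OF Xi(1,3)] Xi(5) by auto
  obtain Y2 where Y2: "Y2 \<in> G" "fst Y2 = fst Y" "proj_sub M V X2 Y2" "proj_sub M V Y2 X2"
      "totals M Y2 = {f \<in> totals M Y. \<exists>g \<in> totals M X2. \<forall>x \<in> V. g x = f x}"
    using ex[OF Xi(2,4)] Xi(5) by auto
  have "totals M Y = totals M Y1 \<union> totals M Y2"
    unfolding Y1(5) Y2(5)
  proof (intro equalityI subsetI)
    fix f assume f: "f \<in> totals M Y"
    with IOr.prems(6) obtain g where "g \<in> totals M X" "\<And>x. x \<in> V \<Longrightarrow> f x = g x"
      by (rule proj_subE) blast
    then show "f \<in> {f \<in> totals M Y. \<exists>g \<in> totals M X1. \<forall>x \<in> V. g x = f x} \<union>
        {f \<in> totals M Y. \<exists>g \<in> totals M X2. \<forall>x \<in> V. g x = f x}"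
      using f Xi(5) by fastforce
  qed auto
  moreover have "il_sat M G \<phi>1 Y1"
    by (rule IOr.IH(1)[OF Xi(1) Y1(1) _ _ Y1(3,4) Xi(6)]) (use IOr.prems(3) V Xi(3) Y1(2) in auto)
  moreover have "il_sat M G \<phi>2 Y2"
    by (rule IOr.IH(2)[OF Xi(2) Y2(1) _ _ Y2(3,4) Xi(7)]) (use IOr.prems(3) V Xi(4) Y2(2) in auto)
  ultimately show ?case
    using Y1(1,2) Y2(1,2) M IOr.prems(2) by (subst il_sat_IOr_iff) blast+
next
  case (IAnd \<phi>1 \<phi>2)
  have "il_sat M G \<phi>1 Y"
    by (rule IAnd.IH(1)[OF IAnd.prems(1,2) _ IAnd.prems(4-6)]) (use IAnd.prems in auto)
  moreover have "il_sat M G \<phi>2 Y"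
    by (rule IAnd.IH(2)[OF IAnd.prems(1,2) _ IAnd.prems(4-6)]) (use IAnd.prems in auto)
  ultimately show ?case by simp
next
  case (IEx x \<phi>)
  note M = general_modelD[OF assms(1)]
  have V: "V \<subseteq> fst X" "V \<subseteq> fst Y" using IEx.prems(4) by auto
  have fin: "finite (insert x (fst Y))" using IEx.prems(2) M by (auto simp: is_team_def)
  obtain X' where X': "X' \<in> G" "fst X' = insert x (fst X)" "proj_sub M (fst X - {x}) X X'"
      "proj_sub M (fst X - {x}) X' X" "il_sat M G \<phi> X'"
    using IEx.prems(7) IEx.prems(1) M by (subst (asm) il_sat_IEx_iff) auto
  \<comment> \<open>Off \<open>x\<close> the new team follows \<open>Y\<close>; on
    \<open>insert x V\<close>, including the new value of \<open>x\<close>, it follows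
    \<open>X'\<close>. Agreement with \<open>Y\<close> at \<open>x\<close> is not demanded, because
    \<open>x\<close> may lie in \<open>V\<close> and have been reassigned.\<close>
  obtain Y' where Y': "Y' \<in> G" "fst Y' = insert x (fst Y)"
    "totals M Y' = {f. range f \<subseteq> Dom M \<and> (\<exists>g \<in> totals M Y. \<forall>y \<in> fst Y - {x}. g y = f y) \<and>
       (\<exists>g \<in> totals M X'. \<forall>y \<in> insert x V. g y = f y)}"
    using general_model_cylinders[OF assms(1) IEx.prems(2) _ X'(1) _ fin, of "fst Y - {x}" "insert x V"]
      V X'(2) by blast
  \<comment> \<open>The witness for two of the projections below: a value at \<open>x\<close> found
    in \<open>X'\<close> is transplanted into a member of \<open>Y\<close>.\<close>
  have upd: "h(x := g x) \<in> totals M Y'"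
    if "h \<in> totals M Y" "g \<in> totals M X'" "\<And>y. y \<in> V - {x} \<Longrightarrow> g y = h y" for g h
    unfolding Y'(3) mem_Collect_eq
  proof (intro conjI)
    show "range (h(x := g x)) \<subseteq> Dom M"
      using totals_range[OF that(1)] totals_range[OF that(2)] by auto
    show "\<exists>h' \<in> totals M Y. \<forall>y \<in> fst Y - {x}. h' y = (h(x := g x)) y"
      by (rule bexI[OF _ that(1)]) simp
    show "\<exists>g' \<in> totals M X'. \<forall>y \<in> insert x V. g' y = (h(x := g x)) y"
      by (rule bexI[OF _ that(2)]) (use that(3) in auto)
  qed
  have "proj_sub M (insert x V) X' Y'"
    unfolding proj_sub_def
  proof
    fix g assume g: "g \<in> totals M X'"
    with X'(4) obtain f where f: "f \<in> totals M X" "\<And>y. y \<in> fst X - {x} \<Longrightarrow> g y = f y"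
      by (rule proj_subE) blast
    obtain h where h: "h \<in> totals M Y" "\<And>y. y \<in> V \<Longrightarrow> f y = h y"
      using IEx.prems(5) f(1) by (rule proj_subE) blast
    have eq: "g y = h y" if "y \<in> V - {x}" for y using that f(2) h(2) V by auto
    then show "\<exists>h \<in> totals M Y'. \<forall>y \<in> insert x V. g y = h y"
      using upd[OF h(1) g] by (intro bexI[of _ "h(x := g x)"]) auto
  qed
  moreover have "proj_sub M (insert x V) Y' X'"
    by (rule proj_subI) (simp add: Y'(3))
  ultimately have "il_sat M G \<phi> Y'"
    by (intro IEx.IH[OF X'(1) Y'(1) _ _ _ _ X'(5), of "insert x V"])
      (use IEx.prems(3) V X'(2) Y'(2) in auto)
  moreover have "proj_sub M (fst Y - {x}) Y Y'"
    unfolding proj_sub_def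
  proof
    fix h assume h: "h \<in> totals M Y"
    with IEx.prems(6) obtain f where f: "f \<in> totals M X" "\<And>y. y \<in> V \<Longrightarrow> h y = f y"
      by (rule proj_subE) blast
    obtain g where g: "g \<in> totals M X'" "\<And>y. y \<in> fst X - {x} \<Longrightarrow> f y = g y"
      using X'(3) f(1) by (rule proj_subE) blast
    have "g y = h y" if "y \<in> V - {x}" for y using that f(2) g(2) V by auto
    then show "\<exists>h' \<in> totals M Y'. \<forall>y \<in> fst Y - {x}. h y = h' y"
      using upd[OF h g(1)] by (intro bexI[of _ "h(x := g x)"]) auto
  qed
  moreover have "proj_sub M (fst Y - {x}) Y' Y"
    by (rule proj_subI) (simp add: Y'(3))
  ultimately show ?case
    using Y'(1,2) M IEx.prems(2) by (subst il_sat_IEx_iff) blast+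
next
  case (IAll x \<phi>)
  note M = general_modelD[OF assms(1)]
  have V: "V \<subseteq> fst X" "V \<subseteq> fst Y" using IAll.prems(4) by auto
  have ex: "\<exists>Z' \<in> G. fst Z' = insert x (fst Z) \<and>
      totals M Z' = {f. range f \<subseteq> Dom M \<and> (\<exists>g \<in> totals M Z. \<forall>y \<in> fst Z - {x}. g y = f y)}"
    if "Z \<in> G" for Z
  proof -
    have "finite (insert x (fst Z))" using that M by (auto simp: is_team_def)
    then show ?thesis
      using general_model_cylinder[OF assms(1) that, of "fst Z - {x}" "insert x (fst Z)"] by blast
  qed
  obtain X' where X': "X' \<in> G" "fst X' = insert x (fst X)"
    "totals M X' = {f. range f \<subseteq> Dom M \<and> (\<exists>g \<in> totals M X. \<forall>y \<in> fst X - {x}. g y = f y)}"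
    using ex[OF IAll.prems(1)] by blast
  obtain Y' where Y': "Y' \<in> G" "fst Y' = insert x (fst Y)"
    "totals M Y' = {f. range f \<subseteq> Dom M \<and> (\<exists>g \<in> totals M Y. \<forall>y \<in> fst Y - {x}. g y = f y)}"
    using ex[OF IAll.prems(2)] by blast
  have sub: "proj_sub M (insert x V) T' U'"
    if TU: "proj_sub M V T U" "V \<subseteq> fst T"
      "totals M T' = {f. range f \<subseteq> Dom M \<and> (\<exists>g \<in> totals M T. \<forall>y \<in> fst T - {x}. g y = f y)}"
      "totals M U' = {f. range f \<subseteq> Dom M \<and> (\<exists>g \<in> totals M U. \<forall>y \<in> fst U - {x}. g y = f y)}"
    for T T' U U'
    unfolding proj_sub_def
  proof
    fix f assume "f \<in> totals M T'"
    then obtain g where f: "range f \<subseteq> Dom M" and g: "g \<in> totals M T" "\<And>y. y \<in> fst T - {x} \<Longrightarrow> g y = f y"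
      using TU(3) by auto
    obtain h where h: "h \<in> totals M U" "\<And>y. y \<in> V \<Longrightarrow> g y = h y"
      using TU(1) g(1) by (rule proj_subE) blast
    \<comment> \<open>Duplication leaves the value at \<open>x\<close> unconstrained, so that of
      \<open>f\<close> can be kept.\<close>
    have "h(x := f x) \<in> totals M U'"
      using totals_range[OF h(1)] f h(1) unfolding TU(4) by (auto intro!: bexI[of _ h])
    moreover have "\<forall>y \<in> insert x V. f y = (h(x := f x)) y"
      using g(2) h(2) TU(2) by fastforce
    ultimately show "\<exists>h \<in> totals M U'. \<forall>y \<in> insert x V. f y = h y" by blast
  qed
  have "il_sat M G \<phi> X'"
    using IAll.prems(7) il_sat_IAll_iff[OF M(1) _ _ X'(2,3), of G \<phi>] IAll.prems(1) X'(1) M(2) by blast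
  then have "il_sat M G \<phi> Y'"
    by (intro IAll.IH[OF X'(1) Y'(1) _ _ sub[OF IAll.prems(5) V(1) X'(3) Y'(3)]
          sub[OF IAll.prems(6) V(2) Y'(3) X'(3)]])
      (use IAll.prems(3) V X'(2) Y'(2) in auto)
  then show ?case
    using il_sat_IAll_iff[OF M(1) _ _ Y'(2,3), of G \<phi>] IAll.prems(2) Y'(1) M(2) by blast
qed

text \<open>Change of domain: variables outside \<open>D\<close> are projected away and those new in
  \<open>D\<close> range freely. This moves the team of a premise to the domain required by the
  conclusion.\<close>

lemma general_model_local_cylinder:
  assumes G: "general_model M G" and X: "X \<in> G" "il_sat M G \<phi> X"
    and D: "finite D" "il_fv \<phi> \<subseteq> fst X \<inter> D"
  shows "\<exists>Z \<in> G. fst Z = D \<and> il_sat M G \<phi> Z \<and>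
    totals M Z = {f. range f \<subseteq> Dom M \<and> (\<exists>g \<in> totals M X. \<forall>x \<in> fst X \<inter> D. g x = f x)}"
proof -
  obtain Z where Z: "Z \<in> G" "fst Z = D"
    "totals M Z = {f. range f \<subseteq> Dom M \<and> (\<exists>g \<in> totals M X. \<forall>x \<in> fst X \<inter> D. g x = f x)}"
    using general_model_cylinder[OF G X(1) order_refl D(1)] by blast
  have "proj_sub M (fst X \<inter> D) X Z"
    unfolding proj_sub_def Z(3) by (auto dest: totals_range)
  moreover have "proj_sub M (fst X \<inter> D) Z X"
    by (rule proj_subI) (simp add: Z(3))
  ultimately have "il_sat M G \<phi> Z"
    using il_sat_local[OF G X(1) Z(1) D(2) _ _ _ X(2)] Z(2) by auto
  then show ?thesis using Z by blast
qed

section \<open>Changing the interpretation of relation symbols\<close>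

lemma interpret_as_sel [simp]:
  "Dom (interpret_as M Rs Xs) = Dom M" "fint (interpret_as M Rs Xs) = fint M"
  by (simp_all add: interpret_as_def)

lemma assignments_interpret_as [simp]: "assignments (interpret_as M Rs Xs) V = assignments M V"
  by (simp add: assignments_def)

lemma rint_interpret_as:
  "rint (interpret_as M Rs Xs) R = (case map_of (zip Rs Xs) R of None \<Rightarrow> rint M R | Some X \<Rightarrow> rel_of X)"
  by (simp add: interpret_as_def)

lemma rint_interpret_as_other: "R \<notin> set Rs \<Longrightarrow> rint (interpret_as M Rs Xs) R = rint M R"
  by (auto simp: rint_interpret_as split: option.split dest!: map_of_SomeD set_zip_leftD)

lemma rel_of_subset:
  assumes "is_team M X"
  shows "rel_of X \<subseteq> {as. length as = team_arity X \<and> set as \<subseteq> Dom M}"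
proof -
  have "the (s x) \<in> Dom M" if "s \<in> snd X" "x \<in> fst X" for s x
  proof -
    have "s \<in> assignments M (fst X)" using assms that(1) by (auto simp: is_team_def)
    then show ?thesis using that(2) by (rule assignments_in_Dom)
  qed
  then show ?thesis
    using assms by (auto simp: rel_of_def team_arity_def is_team_def)
qed

lemma general_model_interpret_as:
  fixes M :: "('f, 'r, 'm) struct"
  assumes G: "general_model M G" and Xs: "set Xs \<subseteq> G" "map team_arity Xs = map snd Ss"
  shows "general_model (interpret_as M Ss Xs) G"
proof -
  let ?N = "interpret_as M Ss Xs"
  have len: "length Xs = length Ss" using Xs(2) by (metis length_map)
  \<comment> \<open>The arity matters: \<open>with_team_rels\<close> gives \<open>Inr X\<close> the
    relation of \<open>X\<close> only at \<open>team_arity X\<close>, and the empty relation at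
    other arities.\<close>
  have lookup: "X \<in> G \<and> team_arity X = k" if *: "map_of (zip Ss Xs) (r, k) = Some X" for r k X
  proof -
    obtain i where "i < length Ss" "Ss ! i = (r, k)" "Xs ! i = X"
      using map_of_SomeD[OF *] len by (auto simp: in_set_zip)
    then show ?thesis
      using Xs len by (metis nth_map nth_mem snd_conv subsetD)
  qed
  have "rint ?N (r, k) \<subseteq> {as. length as = k \<and> set as \<subseteq> Dom M}" for r k
  proof (cases "map_of (zip Ss Xs) (r, k)")
    case None
    then show ?thesis
      using general_modelD(1)[OF G] by (simp add: rint_interpret_as is_structure_def)
  next
    case (Some X)
    then show ?thesis
      using rel_of_subset[of M X] general_modelD(2)[OF G] lookup[OF Some]
      by (auto simp: rint_interpret_as)
  qed
  then have "is_structure ?N"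
    using general_modelD(1)[OF G] by (simp add: is_structure_def)
  moreover have "\<forall>X \<in> G. is_team ?N X"
    using general_modelD(2)[OF G] by (simp add: is_team_def)
  moreover have "(V, {s \<in> assignments ?N V. sat (with_team_rels ?N) (env h s) \<phi>}) \<in> G"
    if \<phi>: "finite V" "free_T \<phi> \<subseteq> V" "free_P \<phi> \<subseteq> dom h" "ran h \<subseteq> Dom ?N"
      "\<forall>X k. (Inr X, k) \<in> rsyms \<phi> \<longrightarrow> X \<in> G \<and> k = team_arity X"
    for \<phi> :: "('f, 'r + 'm team) form" and V h
  proof -
    \<comment> \<open>A reinterpreted symbol becomes the parameter for its team; a symbol with the
      same name but an arity not listed in \<open>Ss\<close> is left alone.\<close>
    define g :: "('r + 'm team) rsym \<Rightarrow> 'r + 'm team" where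
      "g R = (case fst R of Inl r \<Rightarrow> (case map_of (zip Ss Xs) (r, snd R) of None \<Rightarrow> Inl r | Some X \<Rightarrow> Inr X)
                | Inr X \<Rightarrow> Inr X)" for R
    have "sat (with_team_rels M) e (map_rsyms g \<phi>) = sat (with_team_rels ?N) e \<phi>" for e
    proof (rule sat_map_rsyms)
      fix r k
      show "rint (with_team_rels M) (g (r, k), k) = rint (with_team_rels ?N) (r, k)"
        using lookup
        by (auto simp: with_team_rels_def g_def rint_interpret_as split: sum.splits option.splits)
    qed (simp_all add: with_team_rels_def)
    moreover have "X \<in> G \<and> k = team_arity X" if *: "(Inr X, k) \<in> rsyms (map_rsyms g \<phi>)" for X k
    proof -
      obtain R where "R \<in> rsyms \<phi>" "Inr X = g R" "k = snd R"
        using * by (auto simp: rsyms_map_rsyms)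
      then show ?thesis
        using \<phi>(5) lookup by (cases R) (auto simp: g_def split: sum.splits option.splits)
    qed
    then have "(V, {s \<in> assignments M V. sat (with_team_rels M) (env h s) (map_rsyms g \<phi>)}) \<in> G"
      using \<phi>(1-4) by (intro general_model_definable[OF G]) auto
    ultimately show ?thesis by simp
  qed
  ultimately show ?thesis
    unfolding general_model_def by blast
qed

text \<open>The witnesses for \<open>M\<close> still work: symbols bound by the sentence are
  overridden in both structures, and the unbound ones are not among \<open>Ss\<close>.\<close>

lemma theory_closed_interpret_as:
  assumes "theory_closed \<Theta> M G" "set Ss \<inter> theory_rsyms \<Theta> = {}"
  shows "theory_closed \<Theta> (interpret_as M Ss Xs) G"
  unfolding theory_closed_def
proof (clarify)
  fix Rs \<theta> assume \<theta>: "(Rs, \<theta>) \<in> \<Theta>"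
  then obtain Ys where Ys: "set Ys \<subseteq> G" "map team_arity Ys = map snd Rs"
    "\<forall>e. range e \<subseteq> Dom M \<longrightarrow> sat (interpret_as M Rs Ys) e \<theta>"
    using assms(1) by (auto simp: theory_closed_def)
  have len: "length Rs = length Ys" using Ys(2) by (metis length_map)
  have "rint (interpret_as M Rs Ys) R = rint (interpret_as (interpret_as M Ss Xs) Rs Ys) R"
    if "R \<in> rsyms \<theta>" for R
  proof (cases "R \<in> set Rs")
    case True
    then obtain Y where "map_of (zip Rs Ys) R = Some Y"
      using len by (metis map_of_zip_is_Some)
    then show ?thesis by (simp add: rint_interpret_as)
  next
    case False
    then have "R \<in> theory_rsyms \<Theta>"
      using \<theta> that by (auto simp: theory_rsyms_def)
    then have "R \<notin> set Ss" using assms(2) by auto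
    then show ?thesis using False by (simp add: rint_interpret_as_other)
  qed
  then have "sat (interpret_as M Rs Ys) e \<theta> = sat (interpret_as (interpret_as M Ss Xs) Rs Ys) e \<theta>" for e
    by (intro sat_structure_cong) simp_all
  then show "\<exists>Ys. set Ys \<subseteq> G \<and> map team_arity Ys = map snd Rs \<and>
      (\<forall>e. range e \<subseteq> Dom (interpret_as M Ss Xs) \<longrightarrow>
         sat (interpret_as (interpret_as M Ss Xs) Rs Ys) e \<theta>)"
    using Ys by auto
qed

text \<open>Distinctness makes position \<open>i\<close> of \<open>Rs\<close> and of
  \<open>Ss\<close> denote the same team. \<open>Ss\<close> may overlap \<open>Rs\<close>, but must
  avoid the unbound symbols of \<phi>, which would otherwise be reinterpreted.\<close>

lemma sat_replace_rsyms:
  assumes "distinct Rs" "distinct Ss" "map snd Ss = map snd Rs" "length Xs = length Rs"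
    and "set Ss \<inter> (rsyms \<phi> - set Rs) = {}"
  shows "sat (interpret_as M Ss Xs) e (replace_rsyms Rs Ss \<phi>) = sat (interpret_as M Rs Xs) e \<phi>"
  unfolding replace_rsyms_eq_map_rsyms
proof (rule sat_map_rsyms)
  have len: "length Ss = length Rs" using assms(3) by (metis length_map)
  fix r k assume rk: "(r, k) \<in> rsyms \<phi>"
  show "rint (interpret_as M Ss Xs) ((fst \<circ> replace Rs Ss) (r, k), k) = rint (interpret_as M Rs Xs) (r, k)"
  proof (cases "(r, k) \<in> set Rs")
    case True
    then obtain i where i: "i < length Rs" "Rs ! i = (r, k)" by (metis in_set_conv_nth)
    then have "map_of (zip Rs Ss) (r, k) = Some (Ss ! i)" "map_of (zip Rs Xs) (r, k) = Some (Xs ! i)"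
      using map_of_zip_nth[of Rs Ss i] map_of_zip_nth[of Rs Xs i] assms len by auto
    moreover have "map_of (zip Ss Xs) (Ss ! i) = Some (Xs ! i)"
      using map_of_zip_nth[of Ss Xs i] assms len i by auto
    moreover have "snd (Ss ! i) = k"
      using assms(3) i len by (metis nth_map snd_conv)
    then have "(fst (Ss ! i), k) = Ss ! i" by auto
    ultimately show ?thesis by (simp add: rint_interpret_as replace_def)
  next
    case False
    then have "(r, k) \<notin> set Ss" using rk assms(5) by auto
    moreover have "map_of (zip Rs Ss) (r, k) = None"
      using False len by (metis map_of_zip_is_None)
    ultimately show ?thesis
      using False by (simp add: rint_interpret_as_other replace_def)
  qed
qed simp_all

section \<open>Soundness\<close>

text \<open>
  The induction needs a notion of validity in which the domain of the parameter assignment does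
  not change from premise to conclusion.
\<close>

definition total_valid ::
  "'m itself \<Rightarrow> ('f, 'r) rel_ex set \<Rightarrow>
   ('f, 'r) form set \<Rightarrow> ('f, 'r) form \<Rightarrow> ('f, 'r) il \<Rightarrow> bool"
where
  "total_valid U \<Theta> \<Gamma> \<gamma> \<phi> \<longleftrightarrow>
     (\<forall>(M :: ('f, 'r, 'm) struct) G h. general_model M G \<longrightarrow> theory_closed \<Theta> M G \<longrightarrow>
        range h \<subseteq> Dom M \<longrightarrow> (\<forall>\<psi> \<in> \<Gamma>. \<forall>f. range f \<subseteq> Dom M \<longrightarrow> sat M (case_var f h) \<psi>) \<longrightarrow>
        il_sat M G \<phi> (team_of M (Some \<circ> h) \<gamma>))"

lemma total_validI:
  assumes "\<And>(M :: ('f, 'r, 'm) struct) G h. general_model M G \<Longrightarrow> theory_closed \<Theta> M G \<Longrightarrow>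
    range h \<subseteq> Dom M \<Longrightarrow> (\<And>\<psi> f. \<psi> \<in> \<Gamma> \<Longrightarrow> range f \<subseteq> Dom M \<Longrightarrow> sat M (case_var f h) \<psi>) \<Longrightarrow>
    il_sat M G \<phi> (team_of M (Some \<circ> h) \<gamma>)"
  shows "total_valid TYPE('m) \<Theta> \<Gamma> \<gamma> \<phi>"
  using assms unfolding total_valid_def by blast

lemma total_validD:
  fixes M :: "('f, 'r, 'm) struct"
  assumes "total_valid TYPE('m) \<Theta> \<Gamma> \<gamma> \<phi>" "general_model M G" "theory_closed \<Theta> M G" "range h \<subseteq> Dom M"
    "\<And>\<psi> f. \<psi> \<in> \<Gamma> \<Longrightarrow> range f \<subseteq> Dom M \<Longrightarrow> sat M (case_var f h) \<psi>"
  shows "il_sat M G \<phi> (team_of M (Some \<circ> h) \<gamma>)"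
  using assms unfolding total_valid_def by blast

lemma team_of_cong:
  assumes "\<And>p. p \<in> free_P \<gamma> \<Longrightarrow> the (h p) = the (h' p)"
  shows "team_of M h \<gamma> = team_of M h' \<gamma>"
proof -
  have "sat M (env h s) \<gamma> = sat M (env h' s) \<gamma>" for s
  proof (rule sat_cong)
    fix v assume "v \<in> fv \<gamma>"
    then show "env h s v = env h' s v"
      using assms by (cases v) (auto simp: free_P_def)
  qed
  then show ?thesis by (simp add: team_of_def)
qed

lemma valid_if_total_valid:
  fixes \<Theta> :: "('f, 'r) rel_ex set"
  assumes "total_valid TYPE('m) \<Theta> \<Gamma> \<gamma> \<phi>" "sequent \<Gamma> \<gamma> \<phi>"
  shows "valid TYPE('m) \<Theta> \<Gamma> \<gamma> \<phi>"
  unfolding valid_def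
proof (intro allI impI)
  fix M :: "('f, 'r, 'm) struct" and G h
  assume G: "general_model M G" "theory_closed \<Theta> M G"
    and h: "dom h = (\<Union>\<psi> \<in> \<Gamma>. free_P \<psi>) \<union> free_P \<gamma>" "ran h \<subseteq> Dom M"
    and \<Gamma>: "\<forall>\<psi> \<in> \<Gamma>. sat M (env h Map.empty) \<psi>"
  obtain a where a: "a \<in> Dom M"
    using general_modelD(1)[OF G(1)] by (auto simp: is_structure_def)
  \<comment> \<open>The default \<open>a\<close> is used only for parameters outside the domain of
    \<open>h\<close>, which occur free neither in \<Gamma> nor in \<gamma>.\<close>
  define h' where "h' p = (case h p of None \<Rightarrow> a | Some m \<Rightarrow> m)" for p
  have h': "h' p = the (h p)" if "p \<in> dom h" for p
    using that by (auto simp: h'_def)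
  have "range h' \<subseteq> Dom M"
    using a h(2) ranI[of h] by (fastforce simp: h'_def split: option.splits)
  moreover have "sat M (case_var f h') \<psi>" if "\<psi> \<in> \<Gamma>" for \<psi> f
  proof -
    have "sat M (env h Map.empty) \<psi> = sat M (case_var f h') \<psi>"
    proof (rule sat_cong)
      fix v assume v: "v \<in> fv \<psi>"
      have "free_T \<psi> = {}" using assms(2) that by (simp add: sequent_def)
      moreover have "free_P \<psi> \<subseteq> dom h" using h(1) that by auto
      ultimately show "env h Map.empty v = case_var f h' v"
        using v by (cases v) (auto simp: free_T_def free_P_def subset_iff h'[OF domI])
    qed
    then show ?thesis using \<Gamma> that by simp
  qed
  ultimately have "il_sat M G \<phi> (team_of M (Some \<circ> h') \<gamma>)"
    by (intro total_validD[OF assms(1) G])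
  moreover have "team_of M (Some \<circ> h') \<gamma> = team_of M h \<gamma>"
    by (rule team_of_cong) (use h' h(1) in auto)
  ultimately show "il_sat M G \<phi> (team_of M h \<gamma>)" by simp
qed

section \<open>Environments, variable tuples and the semantic content of the rules\<close>

lemma case_var_update:
  "(case_var f h)(TV x := m) = case_var (f(x := m)) h"
  "(case_var f h)(PV p := m) = case_var f (h(p := m))"
  by (auto simp: fun_eq_iff split: var.split)

lemma range_case_var: "range f \<subseteq> A \<Longrightarrow> range h \<subseteq> A \<Longrightarrow> range (case_var f h) \<subseteq> A"
  by (auto simp: image_subset_iff split: var.split)

lemma sat_FAllsD_self: "sat M e (FAlls xs \<phi>) \<Longrightarrow> range e \<subseteq> Dom M \<Longrightarrow> sat M e \<phi>"
  by (erule sat_FAllsD) auto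

lemma sat_no_free_T:
  assumes "free_T \<psi> = {}"
  shows "sat M (case_var f h) \<psi> = sat M (case_var g h) \<psi>"
proof (rule sat_cong)
  fix v assume "v \<in> fv \<psi>"
  then show "case_var f h v = case_var g h v"
    using assms by (cases v) (auto simp: free_T_def)
qed

lemma replace_in_set: "length xs = length ys \<Longrightarrow> x \<in> set xs \<Longrightarrow> replace xs ys x \<in> set ys"
  unfolding replace_def
  by (metis map_of_SomeD map_of_zip_is_Some option.simps(5) set_zip_rightD)

lemma replace_inverse:
  assumes "length xs = length ys" "distinct xs" "distinct ys" "x \<in> set xs"
  shows "replace ys xs (replace xs ys x) = x"
proof -
  obtain i where "i < length xs" "xs ! i = x"
    using assms(4) by (metis in_set_conv_nth)
  then show ?thesis
    using assms map_of_zip_nth[of xs ys i] map_of_zip_nth[of ys xs i] by (auto simp: replace_def)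
qed

lemma replace_map_inj:
  assumes "inj f" "length xs = length ys"
  shows "replace (map f xs) (map f ys) (f x) = f (replace xs ys x)"
  using assms(2) assms(1) by (induction xs ys rule: list_induct2) (auto simp: replace_def inj_eq)

lemma replace_notin: "x \<notin> set xs \<Longrightarrow> replace xs ys x = x"
  by (auto simp: replace_def split: option.split dest!: map_of_SomeD set_zip_leftD)

text \<open>The tuple \<open>ys\<close> is new even with respect to bound variables of \<gamma>, so
  nothing is captured and renaming amounts to precomposition.\<close>

lemma sat_fo_at:
  assumes "set vs = free_T \<gamma>" "length ys = length vs" "TV ` set ys \<inter> all_vars \<gamma> = {}"
  shows "sat M (case_var k h) (fo_at \<gamma> vs ys) = sat M (case_var (k \<circ> replace vs ys) h) \<gamma>"
proof -
  let ?\<rho> = "replace (map TV vs) (map TV ys)"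
  have TV: "?\<rho> (TV x) = TV (replace vs ys x)" for x
    using assms(2) by (intro replace_map_inj) (auto simp: inj_def)
  have PV: "?\<rho> (PV p) = PV p" for p
    by (rule replace_notin) auto
  have "sat M (case_var k h) (fo_at \<gamma> vs ys) = sat M (case_var k h \<circ> ?\<rho>) \<gamma>"
    unfolding fo_at_def
  proof (rule sat_rename_vars)
    fix v assume v: "v \<in> fv \<gamma>"
    show "?\<rho> v \<notin> all_vars \<gamma> \<or> ?\<rho> v = v"
    proof (cases v)
      case (TV x)
      then have "replace vs ys x \<in> set ys"
        using v assms by (intro replace_in_set) (auto simp: free_T_def)
      then show ?thesis using assms(3) TV \<open>?\<rho> (TV x) = TV (replace vs ys x)\<close> by auto
    qed (use PV in simp)
  qed
  also have "case_var k h \<circ> ?\<rho> = case_var (k \<circ> replace vs ys) h"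
    by (auto simp: fun_eq_iff TV PV split: var.split)
  finally show ?thesis .
qed

lemma map_tm_val_tms_at:
  "map (tm_val M (case_var k h)) (tms_at ts vs ys) = map (tm_val M (k \<circ> replace vs ys)) ts"
  by (simp add: tms_at_def tm_val_map_tm comp_def)

text \<open>The assumed sentence is the independence clause itself, with \<open>vs1\<close>,
  \<open>vs2\<close>, \<open>vs3\<close> naming the values of s, s' and s'' on the team
  variables.\<close>

lemma il_sat_IIndep_team_of:
  fixes M :: "('f, 'r, 'm) struct" and \<gamma> :: "('f, 'r) form"
  assumes G: "general_model M G" and h: "range h \<subseteq> Dom M"
    and vs: "set vs = free_T \<gamma>" "distinct vs"
      "length vs1 = length vs" "length vs2 = length vs" "length vs3 = length vs"
      "distinct (vs1 @ vs2 @ vs3)" "TV ` set (vs1 @ vs2 @ vs3) \<inter> all_vars \<gamma> = {}"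
    and fv: "il_fv (IIndep t2 t1 t3 :: ('f, 'r) il) \<subseteq> free_T \<gamma>"
    and sat: "\<And>f. range f \<subseteq> Dom M \<Longrightarrow> sat M (case_var f h) (FAlls (vs1 @ vs2)
       (FImp
         (FConj [fo_at \<gamma> vs vs1, fo_at \<gamma> vs vs2, FEqs (tms_at t1 vs vs1) (tms_at t1 vs vs2)])
         (FExs vs3
           (FConj [fo_at \<gamma> vs vs3,
             FEqs (tms_at (t1 @ t2) vs vs3) (tms_at (t1 @ t2) vs vs1),
             FEqs (tms_at (t1 @ t3) vs vs3) (tms_at (t1 @ t3) vs vs2)]))))"
  shows "il_sat M G (IIndep t2 t1 t3) (team_of M (Some \<circ> h) \<gamma>)"
proof -
  let ?X = "team_of M (Some \<circ> h) \<gamma>" and ?v = "\<lambda>f. map (tm_val M f)"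
  have X: "is_structure M" "is_team M ?X"
    using general_modelD[OF G] team_of_in_general_model[OF G h] by auto
  have v_cong: "?v f t1 = ?v g t1" "?v f (t1 @ t2) = ?v g (t1 @ t2)" "?v f (t1 @ t3) = ?v g (t1 @ t3)"
    if "\<And>x. x \<in> set vs \<Longrightarrow> f x = g x" for f g
    using that fv vs(1) by (auto intro!: tm_val_cong)
  have sat_cong_vs: "sat M (case_var f h) \<gamma> = sat M (case_var g h) \<gamma>"
    if "\<And>x. x \<in> set vs \<Longrightarrow> f x = g x" for f g
  proof (rule sat_cong)
    fix v assume "v \<in> fv \<gamma>"
    then show "case_var f h v = case_var g h v"
      using that vs(1) by (cases v) (auto simp: free_T_def)
  qed
  have fo: "sat M (case_var k h) (fo_at \<gamma> vs ys) = sat M (case_var (k \<circ> replace vs ys) h) \<gamma>"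
    if "ys \<in> {vs1, vs2, vs3}" for k ys
    by (rule sat_fo_at) (use vs that in auto)
  have eqs: "sat M (case_var k h) (FEqs (tms_at ts vs ys) (tms_at ts vs zs)) \<longleftrightarrow>
      ?v (k \<circ> replace vs ys) ts = ?v (k \<circ> replace vs zs) ts" for k ts ys zs
  proof -
    have "length (tms_at ts vs ys) = length (tms_at ts vs zs)" by (simp add: tms_at_def)
    then show ?thesis by (simp only: sat_FEqs map_tm_val_tms_at)
  qed
  have "\<exists>f'' \<in> totals M ?X. ?v f'' (t1 @ t2) = ?v f (t1 @ t2) \<and> ?v f'' (t1 @ t3) = ?v f' (t1 @ t3)"
    if f: "f \<in> totals M ?X" "f' \<in> totals M ?X" "?v f t1 = ?v f' t1" for f f'
  proof -
    \<comment> \<open>One assignment carries both: \<open>f\<close> on the copies \<open>vs1\<close>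
      and \<open>f'\<close> on the copies \<open>vs2\<close>, without conflict because the tuples
      are disjoint. Elsewhere it only has to stay in the domain.\<close>
    define k where "k y = (if y \<in> set vs1 then f (replace vs1 vs y) else f' (replace vs2 vs y))" for y
    have k: "range k \<subseteq> Dom M"
      using totals_range[OF f(1)] totals_range[OF f(2)] by (auto simp: k_def)
    have in_vs: "replace vs vs1 x \<in> set vs1" "replace vs vs2 x \<in> set vs2" if "x \<in> set vs" for x
      using that vs by (auto intro: replace_in_set)
    have k1: "(k \<circ> replace vs vs1) x = f x" if "x \<in> set vs" for x
      using in_vs[OF that] that vs replace_inverse[of vs vs1 x] by (auto simp: k_def)
    have k2: "(k \<circ> replace vs vs2) x = f' x" if "x \<in> set vs" for x
      using in_vs[OF that] that vs replace_inverse[of vs vs2 x] by (auto simp: k_def)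
    have "sat M (case_var k h) (FImp
         (FConj [fo_at \<gamma> vs vs1, fo_at \<gamma> vs vs2, FEqs (tms_at t1 vs vs1) (tms_at t1 vs vs2)])
         (FExs vs3
           (FConj [fo_at \<gamma> vs vs3,
             FEqs (tms_at (t1 @ t2) vs vs3) (tms_at (t1 @ t2) vs vs1),
             FEqs (tms_at (t1 @ t3) vs vs3) (tms_at (t1 @ t3) vs vs2)])))"
      by (rule sat_FAllsD_self[OF sat[OF k] range_case_var[OF k h]])
    moreover have "sat M (case_var k h)
        (FConj [fo_at \<gamma> vs vs1, fo_at \<gamma> vs vs2, FEqs (tms_at t1 vs vs1) (tms_at t1 vs vs2)])"
    proof -
      have "sat M (case_var k h) (fo_at \<gamma> vs vs1)" "sat M (case_var k h) (fo_at \<gamma> vs vs2)"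
        using f(1,2) sat_cong_vs[of "k \<circ> replace vs vs1" f, OF k1]
          sat_cong_vs[of "k \<circ> replace vs vs2" f', OF k2] by (simp_all add: fo totals_team_of)
      moreover have "sat M (case_var k h) (FEqs (tms_at t1 vs vs1) (tms_at t1 vs vs2))"
        unfolding eqs using f(3) v_cong(1)[of "k \<circ> replace vs vs1" f, OF k1]
          v_cong(1)[of "k \<circ> replace vs vs2" f', OF k2] by simp
      ultimately show ?thesis unfolding sat_FConj by simp
    qed
    ultimately have "sat M (case_var k h) (FExs vs3
           (FConj [fo_at \<gamma> vs vs3,
             FEqs (tms_at (t1 @ t2) vs vs3) (tms_at (t1 @ t2) vs vs1),
             FEqs (tms_at (t1 @ t3) vs vs3) (tms_at (t1 @ t3) vs vs2)]))"
      unfolding sat.simps by blast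
    then obtain e where e: "\<forall>v. v \<notin> TV ` set vs3 \<longrightarrow> e v = case_var k h v"
      "\<forall>x \<in> set vs3. e (TV x) \<in> Dom M"
      and e_sat: "sat M e (FConj [fo_at \<gamma> vs vs3,
             FEqs (tms_at (t1 @ t2) vs vs3) (tms_at (t1 @ t2) vs vs1),
             FEqs (tms_at (t1 @ t3) vs vs3) (tms_at (t1 @ t3) vs vs2)])"
      unfolding sat_FExs by blast
    \<comment> \<open>Only values on \<open>vs3\<close> were changed, so the parameter part of
      \<open>e\<close> is still \<open>h\<close>.\<close>
    define k' where "k' = e \<circ> TV"
    have e_eq: "e = case_var k' h"
      using e(1) by (auto simp: k'_def fun_eq_iff split: var.split)
    have k'_k: "k' y = k y" if "y \<notin> set vs3" for y
      using e(1) that by (auto simp: k'_def)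
    have k': "range k' \<subseteq> Dom M"
    proof
      fix m assume "m \<in> range k'"
      then obtain y where "m = k' y" by auto
      then show "m \<in> Dom M"
        using e(2) k k'_k[of y] by (cases "y \<in> set vs3") (auto simp: k'_def)
    qed
    have k'1: "(k' \<circ> replace vs vs1) x = f x" if "x \<in> set vs" for x
      using k1[OF that] in_vs[OF that] vs(6) k'_k[of "replace vs vs1 x"] by auto
    have k'2: "(k' \<circ> replace vs vs2) x = f' x" if "x \<in> set vs" for x
      using k2[OF that] in_vs[OF that] vs(6) k'_k[of "replace vs vs2 x"] by auto
    have "k' \<circ> replace vs vs3 \<in> totals M ?X"
      using e_sat k' unfolding e_eq sat_FConj by (auto simp: fo totals_team_of)
    moreover have "?v (k' \<circ> replace vs vs3) (t1 @ t2) = ?v (k' \<circ> replace vs vs1) (t1 @ t2)"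
      "?v (k' \<circ> replace vs vs3) (t1 @ t3) = ?v (k' \<circ> replace vs vs2) (t1 @ t3)"
      using e_sat unfolding e_eq sat_FConj list.set ball_simps eqs by blast+
    ultimately show ?thesis
      using v_cong(2)[of "k' \<circ> replace vs vs1" f, OF k'1]
        v_cong(3)[of "k' \<circ> replace vs vs2" f', OF k'2]
      by (intro bexI[of _ "k' \<circ> replace vs vs3"] conjI) (simp_all only:)
  qed
  then show ?thesis
    using X fv by (subst il_sat_IIndep_iff) auto
qed

text \<open>The teams of the premises cannot serve directly as the two parts, since their domains
  may differ from \<open>free_T \<gamma>\<close>. Their cylinders over
  \<open>free_T \<gamma>\<close> do, provided that these do not overshoot the team of
  \<gamma>.\<close>

lemma il_sat_IOr_team_of:
  assumes G: "general_model M G" and h: "range h \<subseteq> Dom M"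
    and fv: "il_fv \<phi>1 \<subseteq> free_T \<gamma>1 \<inter> free_T \<gamma>" "il_fv \<phi>2 \<subseteq> free_T \<gamma>2 \<inter> free_T \<gamma>"
    and \<phi>: "il_sat M G \<phi>1 (team_of M (Some \<circ> h) \<gamma>1)" "il_sat M G \<phi>2 (team_of M (Some \<circ> h) \<gamma>2)"
    and iff: "\<And>f. range f \<subseteq> Dom M \<Longrightarrow>
      sat M (case_var f h) \<gamma> \<longleftrightarrow> sat M (case_var f h) \<gamma>1 \<or> sat M (case_var f h) \<gamma>2"
  shows "il_sat M G (IOr \<phi>1 \<phi>2) (team_of M (Some \<circ> h) \<gamma>)"
proof -
  let ?T = "\<lambda>\<gamma>. team_of M (Some \<circ> h) \<gamma>" and ?D = "free_T \<gamma>"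
  note M = general_modelD[OF G]
  have in_G: "?T \<gamma> \<in> G" for \<gamma> by (rule team_of_in_general_model[OF G h])
  obtain Z1 where Z1: "Z1 \<in> G" "fst Z1 = ?D" "il_sat M G \<phi>1 Z1"
    "totals M Z1 = {f. range f \<subseteq> Dom M \<and> (\<exists>g \<in> totals M (?T \<gamma>1). \<forall>x \<in> free_T \<gamma>1 \<inter> ?D. g x = f x)}"
    using general_model_local_cylinder[OF G in_G \<phi>(1) finite_free_T, unfolded fst_team_of, OF fv(1)]
    by blast
  obtain Z2 where Z2: "Z2 \<in> G" "fst Z2 = ?D" "il_sat M G \<phi>2 Z2"
    "totals M Z2 = {f. range f \<subseteq> Dom M \<and> (\<exists>g \<in> totals M (?T \<gamma>2). \<forall>x \<in> free_T \<gamma>2 \<inter> ?D. g x = f x)}"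
    using general_model_local_cylinder[OF G in_G \<phi>(2) finite_free_T, unfolded fst_team_of, OF fv(2)]
    by blast
  have un: "totals M (?T \<gamma>) = totals M (?T \<gamma>1) \<union> totals M (?T \<gamma>2)"
    unfolding totals_team_of using iff by auto
  have ge: "f \<in> totals M (?T \<gamma>)"
    if "range f \<subseteq> Dom M" "g \<in> totals M (?T \<delta>)" "\<forall>x \<in> free_T \<delta> \<inter> ?D. g x = f x" "\<delta> \<in> {\<gamma>1, \<gamma>2}" for f g \<delta>
  proof -
    \<comment> \<open>Gluing: \<open>f\<close> is controlled only on variables shared with \<delta>,
      so \<open>g\<close> fills in the others. The result lies in the team of \<delta>, hence in
      that of \<gamma>, which does not look outside \<open>?D\<close>.\<close>
    define k where "k x = (if x \<in> ?D then f x else g x)" for x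
    have k: "range k \<subseteq> Dom M"
      using that(1) totals_range[OF that(2)] by (auto simp: k_def)
    have "k \<in> totals M (?T \<delta>)"
      using that(2) k by (rule totals_cong) (use that(3) in \<open>auto simp: k_def\<close>)
    then have "k \<in> totals M (?T \<gamma>)" using un that(4) by auto
    then show ?thesis
      using that(1) by (rule totals_cong) (auto simp: k_def)
  qed
  have "totals M (?T \<gamma>) = totals M Z1 \<union> totals M Z2"
  proof
    show "totals M (?T \<gamma>) \<subseteq> totals M Z1 \<union> totals M Z2"
      unfolding un Z1(4) Z2(4) by (auto dest: totals_range)
    show "totals M Z1 \<union> totals M Z2 \<subseteq> totals M (?T \<gamma>)"
      unfolding Z1(4) Z2(4) using ge by blast
  qed
  then show ?thesis
    using Z1(1-3) Z2(1-3) M in_G[of \<gamma>] by (subst il_sat_IOr_iff) (auto simp del: il_sat.simps)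
qed

text \<open>Passing between \<gamma> and \<gamma>' costs a change at \<open>x\<close> only, and this
  coordinate is exempt from the comparison of projections.\<close>

lemma il_sat_IEx_team_of:
  assumes G: "general_model M G" and h: "range h \<subseteq> Dom M"
    and fv: "il_fv \<phi> \<subseteq> free_T \<gamma>' \<inter> insert x (free_T \<gamma>)"
    and \<phi>: "il_sat M G \<phi> (team_of M (Some \<circ> h) \<gamma>')"
    and iff: "\<And>f. range f \<subseteq> Dom M \<Longrightarrow>
      sat M (case_var f h) (FEx (TV x) \<gamma>') \<longleftrightarrow> sat M (case_var f h) (FEx (TV x) \<gamma>)"
  shows "il_sat M G (IEx x \<phi>) (team_of M (Some \<circ> h) \<gamma>)"
proof -
  let ?T = "\<lambda>\<gamma>. team_of M (Some \<circ> h) \<gamma>" and ?D = "insert x (free_T \<gamma>)"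
  note M = general_modelD[OF G]
  have in_G: "?T \<gamma> \<in> G" for \<gamma> by (rule team_of_in_general_model[OF G h])
  have fin: "finite ?D" by (simp add: finite_free_T)
  obtain Z where Z: "Z \<in> G" "fst Z = ?D" "il_sat M G \<phi> Z"
    "totals M Z = {f. range f \<subseteq> Dom M \<and> (\<exists>g \<in> totals M (?T \<gamma>'). \<forall>y \<in> free_T \<gamma>' \<inter> ?D. g y = f y)}"
    using general_model_local_cylinder[OF G in_G \<phi> fin, unfolded fst_team_of, OF fv]
    by blast
  \<comment> \<open>Membership in \<open>totals\<close> already forces \<open>m\<close> into the
    domain, so the quantifiers over \<open>m\<close> carry no bound.\<close>
  have ex: "(\<exists>m. f(x := m) \<in> totals M (?T \<gamma>')) \<longleftrightarrow> (\<exists>m. f(x := m) \<in> totals M (?T \<gamma>))"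
    if "range f \<subseteq> Dom M" for f
  proof -
    have "range (f(x := m)) \<subseteq> Dom M \<longleftrightarrow> m \<in> Dom M" for m
      using that by (auto simp: image_subset_iff)
    then show ?thesis
      using iff[OF that] unfolding totals_team_of by (simp add: case_var_update Bex_def)
  qed
  have "proj_sub M (free_T \<gamma> - {x}) (?T \<gamma>) Z"
    unfolding proj_sub_def
  proof
    fix f assume f: "f \<in> totals M (?T \<gamma>)"
    then have "f(x := f x) \<in> totals M (?T \<gamma>)" by simp
    then obtain m where m: "f(x := m) \<in> totals M (?T \<gamma>')"
      using ex[OF totals_range[OF f]] by blast
    then have "f(x := m) \<in> totals M Z"
      unfolding Z(4) using totals_range[OF m] by blast
    then show "\<exists>g \<in> totals M Z. \<forall>y \<in> free_T \<gamma> - {x}. f y = g y"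
      by (intro bexI[of _ "f(x := m)"]) auto
  qed
  moreover have "proj_sub M (free_T \<gamma> - {x}) Z (?T \<gamma>)"
    unfolding proj_sub_def
  proof
    fix f assume "f \<in> totals M Z"
    then obtain g where f: "range f \<subseteq> Dom M" and g: "g \<in> totals M (?T \<gamma>')"
      "\<forall>y \<in> free_T \<gamma>' \<inter> ?D. g y = f y"
      unfolding Z(4) by blast
    \<comment> \<open>As \<open>f\<close> is controlled only on the shared variables,
      \<open>g\<close> supplies the values outside \<open>?D\<close>; the final comparison stays
      inside \<open>?D\<close>.\<close>
    define k where "k y = (if y \<in> ?D then f y else g y)" for y
    have k: "range k \<subseteq> Dom M"
      using f totals_range[OF g(1)] by (auto simp: k_def)
    have "k \<in> totals M (?T \<gamma>')"
      using g(1) k by (rule totals_cong) (use g(2) in \<open>auto simp: k_def\<close>)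
    then have "k(x := k x) \<in> totals M (?T \<gamma>')" by simp
    then obtain m where "k(x := m) \<in> totals M (?T \<gamma>)"
      using ex[OF k] by blast
    then show "\<exists>g \<in> totals M (?T \<gamma>). \<forall>y \<in> free_T \<gamma> - {x}. f y = g y"
      by (rule bexI[rotated]) (auto simp: k_def)
  qed
  ultimately show ?thesis
    using Z(1-3) M in_G[of \<gamma>] by (subst il_sat_IEx_iff) (auto simp del: il_sat.simps)
qed

text \<open>The duplicated team and the team of \<gamma>' have equal totals. They may still have
  different domains, for instance when \<open>x\<close> is not free in \<gamma>', so locality is
  needed to pass from one to the other.\<close>

lemma il_sat_IAll_team_of:
  assumes G: "general_model M G" and h: "range h \<subseteq> Dom M"
    and fv: "il_fv \<phi> \<subseteq> free_T \<gamma>' \<inter> insert x (free_T \<gamma>)"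
    and \<phi>: "il_sat M G \<phi> (team_of M (Some \<circ> h) \<gamma>')"
    and iff: "\<And>f. range f \<subseteq> Dom M \<Longrightarrow>
      sat M (case_var f h) \<gamma>' \<longleftrightarrow> sat M (case_var f h) (FEx (TV x) \<gamma>)"
  shows "il_sat M G (IAll x \<phi>) (team_of M (Some \<circ> h) \<gamma>)"
proof -
  let ?T = "\<lambda>\<gamma>. team_of M (Some \<circ> h) \<gamma>" and ?D = "insert x (free_T \<gamma>)"
  note M = general_modelD[OF G]
  have in_G: "?T \<gamma> \<in> G" for \<gamma> by (rule team_of_in_general_model[OF G h])
  have fin: "finite ?D" by (simp add: finite_free_T)
  obtain Y where Y: "Y \<in> G" "fst Y = ?D"
    "totals M Y = {f. range f \<subseteq> Dom M \<and> (\<exists>g \<in> totals M (?T \<gamma>). \<forall>y \<in> free_T \<gamma> - {x}. g y = f y)}"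
    using general_model_cylinder[OF G in_G _ fin, of "free_T \<gamma> - {x}" \<gamma>, unfolded fst_team_of] by blast
  have "totals M Y = totals M (?T \<gamma>')"
  proof (intro equalityI subsetI)
    fix f assume "f \<in> totals M Y"
    then obtain g where f: "range f \<subseteq> Dom M" and g: "g \<in> totals M (?T \<gamma>)"
      "\<forall>y \<in> free_T \<gamma> - {x}. g y = f y"
      unfolding Y(3) by blast
    have gx: "g x \<in> Dom M" using totals_range[OF g(1)] by auto
    \<comment> \<open>Restoring the value of \<open>g\<close> at \<open>x\<close> removes the only
      possible disagreement with \<open>g\<close> on \<open>free_T \<gamma>\<close>.\<close>
    have "f(x := g x) \<in> totals M (?T \<gamma>)"
      using g(1) by (rule totals_cong) (use f gx g(2) in auto)
    then show "f \<in> totals M (?T \<gamma>')"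
      using f gx iff[OF f] by (auto simp: totals_team_of case_var_update)
  next
    fix f assume "f \<in> totals M (?T \<gamma>')"
    then have f: "range f \<subseteq> Dom M" "sat M (case_var f h) \<gamma>'"
      by (simp_all add: totals_team_of)
    then obtain m where m: "m \<in> Dom M" "sat M (case_var (f(x := m)) h) \<gamma>"
      using iff[OF f(1)] by (auto simp: case_var_update)
    then have "f(x := m) \<in> totals M (?T \<gamma>)"
      using f(1) by (auto simp: totals_team_of)
    then show "f \<in> totals M Y"
      unfolding Y(3) using f(1) by (auto intro!: bexI[of _ "f(x := m)"] split: if_splits)
  qed
  then have "proj_sub M V (?T \<gamma>') Y" "proj_sub M V Y (?T \<gamma>')" for V
    by (auto simp: proj_sub_def)
  then have "il_sat M G \<phi> Y"
    using il_sat_local[OF G in_G Y(1) fv _ _ _ \<phi>] Y(2) by auto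
  then show ?thesis
    using il_sat_IAll_iff[OF M(1) _ _ , of "?T \<gamma>" Y x G \<phi>] Y M(2) in_G[of \<gamma>] by auto
qed

section \<open>Induction over derivations\<close>

lemma provable_sequent: "provable U \<Theta> \<Gamma> \<gamma> \<phi> \<Longrightarrow> sequent \<Gamma> \<gamma> \<phi>"
  by (induction rule: provable.induct) auto

lemma total_valid_theta:
  fixes \<Theta> :: "('f, 'r) rel_ex set"
  assumes \<Theta>: "relation_existence_theory \<Theta>" "(Rs, FConj Gs) \<in> \<Theta>"
    and Ss: "distinct Ss" "map snd Ss = map snd Rs"
      "set Ss \<inter> ((\<Union>\<psi> \<in> \<Gamma>. rsyms \<psi>) \<union> rsyms \<gamma> \<union> il_rsyms \<phi> \<union> theory_rsyms \<Theta>) = {}"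
    and valid: "total_valid TYPE('m) \<Theta> (replace_rsyms Rs Ss ` set Gs \<union> \<Gamma>) \<gamma> \<phi>"
  shows "total_valid TYPE('m) \<Theta> \<Gamma> \<gamma> \<phi>"
proof (rule total_validI)
  fix M :: "('f, 'r, 'm) struct" and G h
  assume G: "general_model M G" "theory_closed \<Theta> M G" and h: "range h \<subseteq> Dom M"
    and \<Gamma>: "\<And>\<psi> f. \<psi> \<in> \<Gamma> \<Longrightarrow> range f \<subseteq> Dom M \<Longrightarrow> sat M (case_var f h) \<psi>"
  obtain Xs where Xs: "set Xs \<subseteq> G" "map team_arity Xs = map snd Rs"
    "\<And>e. range e \<subseteq> Dom M \<Longrightarrow> sat (interpret_as M Rs Xs) e (FConj Gs)"
    using G(2) \<Theta>(2) unfolding theory_closed_def by blast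
  let ?N = "interpret_as M Ss Xs"
  have other: "rint M R = rint ?N R" if "R \<notin> set Ss" for R
    by (rule rint_interpret_as_other[OF that, symmetric])
  have "il_sat ?N G \<phi> (team_of ?N (Some \<circ> h) \<gamma>)"
  proof (rule total_validD[OF valid])
    show "general_model ?N G"
      using G(1) Xs(1) by (rule general_model_interpret_as) (use Xs(2) Ss(2) in simp)
    show "theory_closed \<Theta> ?N G"
      using G(2) by (rule theory_closed_interpret_as) (use Ss(3) in blast)
    show "range h \<subseteq> Dom ?N" using h by simp
    fix \<psi> and f :: "nat \<Rightarrow> 'm"
    assume \<psi>: "\<psi> \<in> replace_rsyms Rs Ss ` set Gs \<union> \<Gamma>" and f: "range f \<subseteq> Dom ?N"
    then have f': "range f \<subseteq> Dom M" by simp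
    show "sat ?N (case_var f h) \<psi>"
    proof (cases "\<psi> \<in> \<Gamma>")
      case True
      then have "sat M (case_var f h) \<psi> = sat ?N (case_var f h) \<psi>"
        using Ss(3) by (intro sat_structure_cong other) auto
      then show ?thesis using \<Gamma>[OF True f'] by simp
    next
      case False
      then obtain \<theta> where \<theta>: "\<theta> \<in> set Gs" "\<psi> = replace_rsyms Rs Ss \<theta>" using \<psi> by auto
      \<comment> \<open>Unbound symbols of a conjunct are unbound in \<Theta>, so freshness of
        \<open>Ss\<close> for \<Theta> rules out a clash in the renamed axiom.\<close>
      have "rsyms \<theta> - set Rs \<subseteq> theory_rsyms \<Theta>"
      proof -
        have "rsyms \<theta> \<subseteq> rsyms (FConj Gs)" using \<theta>(1) by (auto simp: rsyms_FConj)
        moreover have "rsyms (FConj Gs) - set Rs \<subseteq> theory_rsyms \<Theta>"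
          using \<Theta>(2) by (auto simp: theory_rsyms_def)
        ultimately show ?thesis by blast
      qed
      moreover have "distinct Rs"
        using \<Theta> by (auto simp: relation_existence_theory_def)
      moreover have "length Xs = length Rs" using Xs(2) by (metis length_map)
      ultimately have "sat ?N (case_var f h) \<psi> = sat (interpret_as M Rs Xs) (case_var f h) \<theta>"
        unfolding \<theta>(2) using Ss by (intro sat_replace_rsyms) auto
      then show ?thesis
        using Xs(3)[OF range_case_var[OF f' h]] \<theta>(1) by (simp add: sat_FConj)
    qed
  qed
  moreover have "il_sat M G \<phi> X = il_sat ?N G \<phi> X" for X
    using Ss(3) by (intro il_sat_structure_cong other) auto
  moreover have "sat M e \<gamma> = sat ?N e \<gamma>" for e
    using Ss(3) by (intro sat_structure_cong other) auto
  then have "team_of M (Some \<circ> h) \<gamma> = team_of ?N (Some \<circ> h) \<gamma>"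
    by (simp add: team_of_def)
  ultimately show "il_sat M G \<phi> (team_of M (Some \<circ> h) \<gamma>)" by simp
qed

lemma total_valid_if_provable:
  fixes \<Theta> :: "('f, 'r) rel_ex set"
  assumes "relation_existence_theory \<Theta>" "provable TYPE('m) \<Theta> \<Gamma> \<gamma> \<phi>"
  shows "total_valid TYPE('m) \<Theta> \<Gamma> \<gamma> \<phi>"
  using assms(2)
proof (induction rule: provable.induct)
  case (lit vs \<gamma> l)
  show ?case
  proof (rule total_validI)
    fix M :: "('f, 'r, 'm) struct" and G h
    assume G: "general_model M G" and h: "range h \<subseteq> Dom M"
      and sat: "\<And>\<psi> f. \<psi> \<in> {FAlls vs (FImp \<gamma> (literal_fo l))} \<Longrightarrow> range f \<subseteq> Dom M \<Longrightarrow>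
        sat M (case_var f h) \<psi>"
    have "literal_sat M f l" if f: "f \<in> totals M (team_of M (Some \<circ> h) \<gamma>)" for f
    proof -
      have "sat M (case_var f h) (FImp \<gamma> (literal_fo l))"
        using sat_FAllsD_self[OF sat[OF _ totals_range[OF f]] range_case_var[OF totals_range[OF f] h]]
        by blast
      moreover have "case_var f h \<circ> TV = f" by auto
      ultimately show ?thesis using f by (simp add: totals_team_of sat_literal_fo)
    qed
    moreover have "literal_vars l \<subseteq> free_T \<gamma>" using lit by (simp add: sequent_def)
    ultimately show "il_sat M G (ILit l) (team_of M (Some \<circ> h) \<gamma>)"
      using general_modelD[OF G] team_of_in_general_model[OF G h]
      by (subst il_sat_ILit_iff) auto
  qed
next
  case (ind vs \<gamma> vs1 vs2 vs3 \<psi> t1 t2 t3)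
  show ?case
  proof (rule total_validI)
    fix M :: "('f, 'r, 'm) struct" and G h
    assume G: "general_model M G" and h: "range h \<subseteq> Dom M"
      and sat: "\<And>\<psi>' f. \<psi>' \<in> {\<psi>} \<Longrightarrow> range f \<subseteq> Dom M \<Longrightarrow> sat M (case_var f h) \<psi>'"
    have fv: "il_fv (IIndep t2 t1 t3 :: ('f, 'r) il) \<subseteq> free_T \<gamma>"
      using ind(9) by (simp add: sequent_def)
    show "il_sat M G (IIndep t2 t1 t3) (team_of M (Some \<circ> h) \<gamma>)"
      by (rule il_sat_IIndep_team_of[OF G h ind(2,1,3-7) fv]) (use sat ind(8) in blast)
  qed
next
  case (disj \<Gamma>1 \<gamma>1 \<phi>1 \<Gamma>2 \<gamma>2 \<phi>2 \<Gamma> vs \<gamma>)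
  have fv: "il_fv \<phi>1 \<subseteq> free_T \<gamma>1 \<inter> free_T \<gamma>" "il_fv \<phi>2 \<subseteq> free_T \<gamma>2 \<inter> free_T \<gamma>"
    using provable_sequent[OF disj(1)] provable_sequent[OF disj(2)] disj.hyps(4)
    by (auto simp: sequent_def)
  show ?case
  proof (rule total_validI)
    fix M :: "('f, 'r, 'm) struct" and G h
    assume G: "general_model M G" "theory_closed \<Theta> M G" and h: "range h \<subseteq> Dom M"
      and sat: "\<And>\<psi> f. \<psi> \<in> \<Gamma> \<Longrightarrow> range f \<subseteq> Dom M \<Longrightarrow> sat M (case_var f h) \<psi>"
    show "il_sat M G (IOr \<phi>1 \<phi>2) (team_of M (Some \<circ> h) \<gamma>)"
    proof (rule il_sat_IOr_team_of[OF G(1) h fv])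
      show "il_sat M G \<phi>1 (team_of M (Some \<circ> h) \<gamma>1)"
        by (rule total_validD[OF disj.IH(1) G h]) (use sat disj.hyps(3) in blast)
      show "il_sat M G \<phi>2 (team_of M (Some \<circ> h) \<gamma>2)"
        by (rule total_validD[OF disj.IH(2) G h]) (use sat disj.hyps(3) in blast)
      fix f :: "nat \<Rightarrow> 'm" assume f: "range f \<subseteq> Dom M"
      have "sat M (case_var f h) (FIff \<gamma> (FOr \<gamma>1 \<gamma>2))"
        by (rule sat_FAllsD_self[OF sat[OF _ f] range_case_var[OF f h]]) (use disj.hyps(3) in blast)
      then show "sat M (case_var f h) \<gamma> \<longleftrightarrow> sat M (case_var f h) \<gamma>1 \<or> sat M (case_var f h) \<gamma>2"
        by auto
    qed
  qed
next
  case (conj \<Gamma>1 \<gamma> \<phi>1 \<Gamma>2 \<phi>2)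
  then show ?case unfolding total_valid_def by simp
next
  case (exists \<Gamma> \<gamma>' \<phi> \<Gamma>' vs x \<gamma>)
  have fv: "il_fv \<phi> \<subseteq> free_T \<gamma>' \<inter> insert x (free_T \<gamma>)"
    using provable_sequent[OF exists.hyps(1)] exists.hyps(3) by (auto simp: sequent_def)
  show ?case
  proof (rule total_validI)
    fix M :: "('f, 'r, 'm) struct" and G h
    assume G: "general_model M G" "theory_closed \<Theta> M G" and h: "range h \<subseteq> Dom M"
      and sat: "\<And>\<psi> f. \<psi> \<in> \<Gamma>' \<Longrightarrow> range f \<subseteq> Dom M \<Longrightarrow> sat M (case_var f h) \<psi>"
    show "il_sat M G (IEx x \<phi>) (team_of M (Some \<circ> h) \<gamma>)"
    proof (rule il_sat_IEx_team_of[OF G(1) h fv])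
      show "il_sat M G \<phi> (team_of M (Some \<circ> h) \<gamma>')"
        by (rule total_validD[OF exists.IH G h]) (use sat exists.hyps(2) in blast)
      fix f :: "nat \<Rightarrow> 'm" assume f: "range f \<subseteq> Dom M"
      have "sat M (case_var f h) (FIff (FEx (TV x) \<gamma>') (FEx (TV x) \<gamma>))"
        by (rule sat_FAllsD_self[OF sat[OF _ f] range_case_var[OF f h]]) (use exists.hyps(2) in blast)
      then show "sat M (case_var f h) (FEx (TV x) \<gamma>') \<longleftrightarrow> sat M (case_var f h) (FEx (TV x) \<gamma>)"
        unfolding sat.simps by blast
    qed
  qed
next
  case (forall \<Gamma> \<gamma>' \<phi> \<Gamma>' vs x \<gamma>)
  have fv: "il_fv \<phi> \<subseteq> free_T \<gamma>' \<inter> insert x (free_T \<gamma>)"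
    using provable_sequent[OF forall.hyps(1)] forall.hyps(3) by (auto simp: sequent_def)
  show ?case
  proof (rule total_validI)
    fix M :: "('f, 'r, 'm) struct" and G h
    assume G: "general_model M G" "theory_closed \<Theta> M G" and h: "range h \<subseteq> Dom M"
      and sat: "\<And>\<psi> f. \<psi> \<in> \<Gamma>' \<Longrightarrow> range f \<subseteq> Dom M \<Longrightarrow> sat M (case_var f h) \<psi>"
    show "il_sat M G (IAll x \<phi>) (team_of M (Some \<circ> h) \<gamma>)"
    proof (rule il_sat_IAll_team_of[OF G(1) h fv])
      show "il_sat M G \<phi> (team_of M (Some \<circ> h) \<gamma>')"
        by (rule total_validD[OF forall.IH G h]) (use sat forall.hyps(2) in blast)
      fix f :: "nat \<Rightarrow> 'm" assume f: "range f \<subseteq> Dom M"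
      have "sat M (case_var f h) (FIff \<gamma>' (FEx (TV x) \<gamma>))"
        by (rule sat_FAllsD_self[OF sat[OF _ f] range_case_var[OF f h]]) (use forall.hyps(2) in blast)
      then show "sat M (case_var f h) \<gamma>' \<longleftrightarrow> sat M (case_var f h) (FEx (TV x) \<gamma>)"
        unfolding sat.simps by blast
    qed
  qed
next
  case (ent \<Gamma> \<gamma> \<phi> \<Gamma>')
  show ?case
  proof (rule total_validI)
    fix M :: "('f, 'r, 'm) struct" and G h
    assume G: "general_model M G" "theory_closed \<Theta> M G" and h: "range h \<subseteq> Dom M"
      and sat: "\<And>\<psi> f. \<psi> \<in> \<Gamma>' \<Longrightarrow> range f \<subseteq> Dom M \<Longrightarrow> sat M (case_var f h) \<psi>"
    have "sat M (case_var f h) \<psi>" if "\<psi> \<in> \<Gamma>" "range f \<subseteq> Dom M" for \<psi> f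
      using ent.hyps(2) general_modelD(1)[OF G(1)] range_case_var[OF that(2) h] sat that
      unfolding entails_def by blast
    then show "il_sat M G \<phi> (team_of M (Some \<circ> h) \<gamma>)"
      by (rule total_validD[OF ent.IH G h])
  qed
next
  case (depar Gs \<gamma> \<phi> p)
  show ?case
  proof (rule total_validI)
    fix M :: "('f, 'r, 'm) struct" and G h
    assume G: "general_model M G" "theory_closed \<Theta> M G" and h: "range h \<subseteq> Dom M"
      and sat: "\<And>\<psi> f. \<psi> \<in> {FEx (PV p) (FConj Gs)} \<Longrightarrow> range f \<subseteq> Dom M \<Longrightarrow> sat M (case_var f h) \<psi>"
    \<comment> \<open>The premises have no free team variables, so any function into the domain may
      stand for the team part; \<open>h\<close> is at hand. This yields one \<open>m\<close> that is
      good for every \<open>f\<close>.\<close>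
    obtain m where m: "m \<in> Dom M" "sat M (case_var h (h(p := m))) (FConj Gs)"
      using sat[OF _ h] by (auto simp: case_var_update)
    have "il_sat M G \<phi> (team_of M (Some \<circ> h(p := m)) \<gamma>)"
    proof (rule total_validD[OF depar.IH G])
      show "range (h(p := m)) \<subseteq> Dom M" using h m(1) by auto
      fix \<psi> f assume "\<psi> \<in> set Gs"
      moreover have "free_T \<psi> = {}"
        using \<open>\<psi> \<in> set Gs\<close> provable_sequent[OF depar.hyps(1)] by (simp add: sequent_def)
      ultimately show "sat M (case_var f (h(p := m))) \<psi>"
        using m(2) sat_no_free_T[of \<psi> M f _ h] by (simp add: sat_FConj)
    qed
    moreover have "team_of M (Some \<circ> h(p := m)) \<gamma> = team_of M (Some \<circ> h) \<gamma>"
      by (rule team_of_cong) (use depar.hyps(2) in auto)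
    ultimately show "il_sat M G \<phi> (team_of M (Some \<circ> h) \<gamma>)" by simp
  qed
next
  case (split Gs1 \<gamma> \<phi> Gs2)
  show ?case
  proof (rule total_validI)
    fix M :: "('f, 'r, 'm) struct" and G h
    assume G: "general_model M G" "theory_closed \<Theta> M G" and h: "range h \<subseteq> Dom M"
      and sat: "\<And>\<psi> f. \<psi> \<in> {FOr (FConj Gs1) (FConj Gs2)} \<Longrightarrow> range f \<subseteq> Dom M \<Longrightarrow> sat M (case_var f h) \<psi>"
    have closed: "free_T \<psi> = {}" if "\<psi> \<in> set Gs1 \<union> set Gs2" for \<psi>
      using that provable_sequent[OF split.hyps(1)] provable_sequent[OF split.hyps(2)]
      by (auto simp: sequent_def)
    \<comment> \<open>The disjunction is decided once, with \<open>h\<close> as team part. As the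
      conjuncts have no free team variables, the same side then holds for every
      \<open>f\<close>.\<close>
    have "sat M (case_var h h) (FConj Gs1) \<or> sat M (case_var h h) (FConj Gs2)"
      using sat[OF _ h] by simp
    then show "il_sat M G \<phi> (team_of M (Some \<circ> h) \<gamma>)"
    proof
      assume "sat M (case_var h h) (FConj Gs1)"
      then have "sat M (case_var f h) \<psi>" if "\<psi> \<in> set Gs1" for \<psi> f
        using that sat_no_free_T[OF closed, of \<psi> M f h h] by (simp add: sat_FConj)
      then show ?thesis by (intro total_validD[OF split.IH(1) G h])
    next
      assume "sat M (case_var h h) (FConj Gs2)"
      then have "sat M (case_var f h) \<psi>" if "\<psi> \<in> set Gs2" for \<psi> f
        using that sat_no_free_T[OF closed, of \<psi> M f h h] by (simp add: sat_FConj)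
      then show ?thesis by (intro total_validD[OF split.IH(2) G h])
    qed
  qed
next
  case (theta Rs Ss Gs \<Gamma>2 \<gamma> \<phi>)
  show ?case
    by (rule total_valid_theta[OF assms(1) theta.hyps(2-5) theta.IH])
qed

theorem mainTheorem4:
  fixes \<Theta> :: "('f, 'r) rel_ex set"
    and \<Gamma> :: "('f, 'r) form set"
    and \<gamma> :: "('f, 'r) form"
    and \<phi> :: "('f, 'r) il"
  assumes "relation_existence_theory \<Theta>"
    and "sequent \<Gamma> \<gamma> \<phi>"
    and "provable TYPE('m) \<Theta> \<Gamma> \<gamma> \<phi>"
  shows "valid TYPE('m) \<Theta> \<Gamma> \<gamma> \<phi>"
  using valid_if_total_valid total_valid_if_provable assms by blast

end
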